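(* Let $\mathcal{C}$ be a uni-fractionable category. (a) Given parallel $3$-arrows $(b_1,f_1,a_1)$ and $(b_2,f_2,a_2)$ in $\mathcal{C}$ (same source, same target), we have $b_1\backslash f_1/a_1=b_2\backslash f_2/a_2$ in $\mathrm{Frac}\,\mathcal{C}$ if and only if there exist $3$-arrows $(\tilde b_1,\tilde f_1,\tilde a_1)$, $(\tilde b_2,\tilde f_2,\tilde a_2)$ (with the same source and target as the given ones) and normal $3$-arrows $(p_1,d_1,i_1)$, $(p_2,d_2,i_2)$ with $d_1,d_2$ denominators in $\mathcal{C}$ such that $$\tilde b_1=p_1b_1,\quad \tilde f_1p_2=p_1f_1,\quad \tilde a_1p_2=a_1,$$ $$\tilde b_1=d_1\tilde b_2,\quad \tilde f_1d_2=d_1\tilde f_2,\quad \tilde a_1d_2=\tilde a_2,$$ $$b_2=i_1\tilde b_2,\quad f_2i_2=i_1\tilde f_2,\quad a_2i_2=\tilde a_2,$$ i.e. fitting into a commutative diagram with rows $(b_1,f_1,a_1)$, $(\tilde b_1,\tilde f_1,\tilde a_1)$, $(\tilde b_2,\tilde f_2,\tilde a_2)$, $(b_2,f_2,a_2)$, with middle columns $(p_1,d_1,i_1)$, $(p_2,d_2,i_2)$, and with identities in the outer columns. If $(b_1,f_1,a_1)$ and $(b_2,f_2,a_2)$ are normal $3$-arrows, then $(\tilde b_1,\tilde f_1,\tilde a_1)$ and $(\tilde b_2,\tilde f_2,\tilde a_2)$ can be chosen to be normal, too. (b) Let $(b_1,f_1,a_1)$, $(b_2,f_2,a_2)$ be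 $3$-arrows and $(p_1,g_1,i_1)$, $(p_2,g_2,i_2)$ normal $3$-arrows in $\mathcal{C}$ such that both composites in the following equation are defined. Then $$(b_1\backslash f_1/a_1)(p_2\backslash g_2/i_2)=(p_1\backslash g_1/i_1)(b_2\backslash f_2/a_2)$$ in $\mathrm{Frac}\,\mathcal{C}$ if and only if there exist $3$-arrows $(\tilde b_1,\tilde f_1,\tilde a_1)$, $(\tilde b_2,\tilde f_2,\tilde a_2)$ and normal $3$-arrows $(\tilde p_1,\tilde g_1,\tilde i_1)$, $(\tilde p_2,\tilde g_2,\tilde i_2)$ in $\mathcal{C}$ (with sources and targets such that all the following composites are defined) satisfying $$\tilde b_1p_1=\tilde p_1b_1,\quad \tilde f_1\tilde p_2=\tilde p_1f_1,\quad \tilde a_1\tilde p_2=p_2a_1,$$ $$\tilde b_1g_1=\tilde g_1\tilde b_2,\quad \tilde f_1\tilde g_2=\tilde g_1\tilde f_2,\quad \tilde a_1\tilde g_2=g_2\tilde a_2,$$ $$b_2i_1=\tilde i_1\tilde b_2,\quad f_2\tilde i_2=\tilde i_1\tilde f_2,\quad a_2\tilde i_2=i_2\tilde a_2.$$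
   Context: Composition is written diagrammatically: for $f\colon X\to Y$, $g\colon Y\to Z$ the composite is $fg\colon X\to Z$. A category with denominators is a category $\mathcal{C}$ together with a subset $\mathrm{Den}\,\mathcal{C}\subseteq\mathrm{Mor}\,\mathcal{C}$, whose elements are called denominators. A subset $D\subseteq\mathrm{Mor}\,\mathcal{C}$ is multiplicative if it contains all identities and is closed under composition; it is semi-saturated if it is multiplicative and, for composable $f,g$, whenever two of $f,g,fg$ are in $D$, so is the third. A uni-fractionable category is a category with denominators $\mathcal{C}$ with $\mathrm{Den}\,\mathcal{C}$ semi-saturated, together with multiplicative subsets $\mathrm{SDen}\,\mathcal{C},\mathrm{TDen}\,\mathcal{C}\subseteq\mathrm{Den}\,\mathcal{C}$ (S-denominators, T-denominators) such that: (WU) for $i\in\mathrm{SDen}\,\mathcal{C}$ and a morphism $f$ with the same source as $i$ there is a weak pushout square $if'=fi'$ of $i$ and $f$ with $i'\in\mathrm{SDen}\,\mathcal{C}$; dually, for $p\in\mathrm{TDen}\,\mathcal{C}$ and a morphism $f$ with the same target as $p$ there is a weak pullback square $f'p=p'f$ of $f$ and $p$ with $p'\in\mathrm{TDen}\,\mathcal{C}$; (Fac) for every $d\in\mathrm{Den}\,\mathcal{C}$ there are $i\in\mathrm{SDen}\,\mathcal{C}$, $p\in\mathrm{TDen}\,\mathcal{C}$ with $d=ip$. (Weak pushout/pullback: universal property without uniqueness.) A $3$-arrow $(b,f,a)\colon X\leftarrow\tilde X\to\tilde Y\leftarrow Y$ in $\mathcal{C}$ consists of denominators $b\colon\tilde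 X\to X$, $a\colon Y\to\tilde Y$ and a morphism $f\colon\tilde X\to\tilde Y$; its source is $X$ and its target is $Y$. It is normal if $b$ is a T-denominator and $a$ is an S-denominator. Fraction equality is the equivalence relation $\equiv$ on $3$-arrows generated by $(b,f,a)\equiv(b,fc,ac)$ whenever $ac\in\mathrm{Den}\,\mathcal{C}$ and $(b,f,a)\equiv(cb,cf,a)$ whenever $cb\in\mathrm{Den}\,\mathcal{C}$; the class of $(b,f,a)$ is the double fraction $b\backslash f/a$. The fraction category $\mathrm{Frac}\,\mathcal{C}$ has the objects of $\mathcal{C}$, double fractions as morphisms (source and target as for $3$-arrows), identities $1_X\backslash 1_X/1_X$, and the following composition (independent of all choices): choose an S-denominator $j$ and a T-denominator $q$ with $b_2a_1=jq$, a T-denominator $q'$ and a morphism $f_1'$ with $f_1'q=q'f_1$, and an S-denominator $j'$ and a morphism $f_2'$ with $jf_2'=f_2j'$; then $(b_1\backslash f_1/a_1)(b_2\backslash f_2/a_2)=q'b_1\backslash f_1'f_2'/a_2j'$. *)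

theory Defs
  imports Main
begin

(* Composition is diagrammatic: f \<cdot> g is "first f, then g".  It is a total
   function on the type of morphisms, meaningful only if Tgt f = Src g. *)
record ('o, 'm) category =
  Obj :: "'o set"
  Mor :: "'m set"
  Src :: "'m \<Rightarrow> 'o"
  Tgt :: "'m \<Rightarrow> 'o"
  Idt :: "'o \<Rightarrow> 'm"
  Cmp :: "'m \<Rightarrow> 'm \<Rightarrow> 'm" (infixl "\<cdot>\<index>" 70)

definition hom :: "('o, 'm, 'x) category_scheme \<Rightarrow> 'o \<Rightarrow> 'o \<Rightarrow> 'm set" where
  "hom C X Y = {f \<in> Mor C. Src C f = X \<and> Tgt C f = Y}"

locale category =
  fixes C :: "('o, 'm, 'x) category_scheme" (structure)
  assumes Src_in_Obj: "f \<in> Mor C \<Longrightarrow> Src C f \<in> Obj C"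
    and Tgt_in_Obj: "f \<in> Mor C \<Longrightarrow> Tgt C f \<in> Obj C"
    and Idt_in_hom: "X \<in> Obj C \<Longrightarrow> Idt C X \<in> hom C X X"
    and Cmp_in_hom: "\<lbrakk>f \<in> hom C X Y; g \<in> hom C Y Z\<rbrakk> \<Longrightarrow> f \<cdot> g \<in> hom C X Z"
    and Cmp_assoc:
      "\<lbrakk>f \<in> hom C W X; g \<in> hom C X Y; h \<in> hom C Y Z\<rbrakk> \<Longrightarrow> (f \<cdot> g) \<cdot> h = f \<cdot> (g \<cdot> h)"
    and Idt_left: "f \<in> hom C X Y \<Longrightarrow> Idt C X \<cdot> f = f"
    and Idt_right: "f \<in> hom C X Y \<Longrightarrow> f \<cdot> Idt C Y = f"

definition multiplicative :: "('o, 'm, 'x) category_scheme \<Rightarrow> 'm set \<Rightarrow> bool" where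
  "multiplicative C D \<longleftrightarrow>
     D \<subseteq> Mor C \<and>
     (\<forall>X \<in> Obj C. Idt C X \<in> D) \<and>
     (\<forall>f \<in> D. \<forall>g \<in> D. Tgt C f = Src C g \<longrightarrow> f \<cdot>\<^bsub>C\<^esub> g \<in> D)"

definition semi_saturated :: "('o, 'm, 'x) category_scheme \<Rightarrow> 'm set \<Rightarrow> bool" where
  "semi_saturated C D \<longleftrightarrow>
     multiplicative C D \<and>
     (\<forall>f \<in> Mor C. \<forall>g \<in> Mor C. Tgt C f = Src C g \<longrightarrow>
        (f \<in> D \<and> f \<cdot>\<^bsub>C\<^esub> g \<in> D \<longrightarrow> g \<in> D) \<and>
        (g \<in> D \<and> f \<cdot>\<^bsub>C\<^esub> g \<in> D \<longrightarrow> f \<in> D))"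

(* weak_pushout C i f f' i': the square i \<cdot> f' = f \<cdot> i' is a weak pushout of i and f. *)
definition weak_pushout ::
    "('o, 'm, 'x) category_scheme \<Rightarrow> 'm \<Rightarrow> 'm \<Rightarrow> 'm \<Rightarrow> 'm \<Rightarrow> bool" where
  "weak_pushout C i f f' i' \<longleftrightarrow>
     i \<in> Mor C \<and> f \<in> Mor C \<and> Src C i = Src C f \<and>
     (\<exists>W. f' \<in> hom C (Tgt C i) W \<and> i' \<in> hom C (Tgt C f) W \<and>
        i \<cdot>\<^bsub>C\<^esub> f' = f \<cdot>\<^bsub>C\<^esub> i' \<and>
        (\<forall>V. \<forall>u \<in> hom C (Tgt C i) V. \<forall>v \<in> hom C (Tgt C f) V.
           i \<cdot>\<^bsub>C\<^esub> u = f \<cdot>\<^bsub>C\<^esub> v \<longrightarrow>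
           (\<exists>w \<in> hom C W V. f' \<cdot>\<^bsub>C\<^esub> w = u \<and> i' \<cdot>\<^bsub>C\<^esub> w = v)))"

(* weak_pullback C f p f' p': the square f' \<cdot> p = p' \<cdot> f is a weak pullback of f and p. *)
definition weak_pullback ::
    "('o, 'm, 'x) category_scheme \<Rightarrow> 'm \<Rightarrow> 'm \<Rightarrow> 'm \<Rightarrow> 'm \<Rightarrow> bool" where
  "weak_pullback C f p f' p' \<longleftrightarrow>
     f \<in> Mor C \<and> p \<in> Mor C \<and> Tgt C f = Tgt C p \<and>
     (\<exists>W. f' \<in> hom C W (Src C p) \<and> p' \<in> hom C W (Src C f) \<and>
        f' \<cdot>\<^bsub>C\<^esub> p = p' \<cdot>\<^bsub>C\<^esub> f \<and>
        (\<forall>V. \<forall>u \<in> hom C V (Src C p). \<forall>v \<in> hom C V (Src C f).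
           u \<cdot>\<^bsub>C\<^esub> p = v \<cdot>\<^bsub>C\<^esub> f \<longrightarrow>
           (\<exists>w \<in> hom C V W. w \<cdot>\<^bsub>C\<^esub> f' = u \<and> w \<cdot>\<^bsub>C\<^esub> p' = v)))"

record ('o, 'm) den_category = "('o, 'm) category" +
  Den :: "'m set"

record ('o, 'm) uni_fractionable_category = "('o, 'm) den_category" +
  SDen :: "'m set"
  TDen :: "'m set"

locale category_with_denominators = category C
  for C :: "('o, 'm, 'x) den_category_scheme" (structure) +
  assumes Den_subset_Mor: "Den C \<subseteq> Mor C"

locale uni_fractionable_category = category_with_denominators C
  for C :: "('o, 'm, 'x) uni_fractionable_category_scheme" (structure) +
  assumes semi_saturated_Den: "semi_saturated C (Den C)"
    and SDen_subset_Den: "SDen C \<subseteq> Den C"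
    and multiplicative_SDen: "multiplicative C (SDen C)"
    and TDen_subset_Den: "TDen C \<subseteq> Den C"
    and multiplicative_TDen: "multiplicative C (TDen C)"
    and weak_universality_SDen:
      "\<lbrakk>i \<in> SDen C; f \<in> Mor C; Src C f = Src C i\<rbrakk>
       \<Longrightarrow> \<exists>f' i'. weak_pushout C i f f' i' \<and> i' \<in> SDen C"
    and weak_universality_TDen:
      "\<lbrakk>p \<in> TDen C; f \<in> Mor C; Tgt C f = Tgt C p\<rbrakk>
       \<Longrightarrow> \<exists>f' p'. weak_pullback C f p f' p' \<and> p' \<in> TDen C"
    and factorisation:
      "d \<in> Den C \<Longrightarrow> \<exists>i \<in> SDen C. \<exists>p \<in> TDen C. Tgt C i = Src C p \<and> d = i \<cdot> p"

type_synonym 'm three_arrow = "'m \<times> 'm \<times> 'm"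

(* The 3-arrows with source X and target Y. *)
definition three_arrows ::
    "('o, 'm, 'x) den_category_scheme \<Rightarrow> 'o \<Rightarrow> 'o \<Rightarrow> 'm three_arrow set" where
  "three_arrows C X Y =
     {(b, f, a). b \<in> Den C \<and> f \<in> Mor C \<and> a \<in> Den C \<and>
        b \<in> hom C (Src C f) X \<and> a \<in> hom C Y (Tgt C f)}"

definition normal_three_arrows ::
    "('o, 'm, 'x) uni_fractionable_category_scheme \<Rightarrow> 'o \<Rightarrow> 'o \<Rightarrow> 'm three_arrow set" where
  "normal_three_arrows C X Y =
     {(b, f, a). (b, f, a) \<in> three_arrows C X Y \<and> b \<in> TDen C \<and> a \<in> SDen C}"

inductive fraction_equal ::
    "('o, 'm, 'x) den_category_scheme \<Rightarrow> 'm three_arrow \<Rightarrow> 'm three_arrow \<Rightarrow> bool"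
  for C :: "('o, 'm, 'x) den_category_scheme" where
  right: "\<lbrakk>(b, f, a) \<in> three_arrows C X Y; c \<in> Mor C; Src C c = Tgt C f; a \<cdot>\<^bsub>C\<^esub> c \<in> Den C\<rbrakk>
    \<Longrightarrow> fraction_equal C (b, f, a) (b, f \<cdot>\<^bsub>C\<^esub> c, a \<cdot>\<^bsub>C\<^esub> c)"
| left: "\<lbrakk>(b, f, a) \<in> three_arrows C X Y; c \<in> Mor C; Tgt C c = Src C f; c \<cdot>\<^bsub>C\<^esub> b \<in> Den C\<rbrakk>
    \<Longrightarrow> fraction_equal C (b, f, a) (c \<cdot>\<^bsub>C\<^esub> b, c \<cdot>\<^bsub>C\<^esub> f, a)"
| refl: "A \<in> three_arrows C X Y \<Longrightarrow> fraction_equal C A A"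
| sym: "fraction_equal C A B \<Longrightarrow> fraction_equal C B A"
| trans: "\<lbrakk>fraction_equal C A B; fraction_equal C B D\<rbrakk> \<Longrightarrow> fraction_equal C A D"

definition double_fraction ::
    "('o, 'm, 'x) den_category_scheme \<Rightarrow> 'm three_arrow \<Rightarrow> 'm three_arrow set" where
  "double_fraction C A = {B. fraction_equal C A B}"

(* The composite is independent of the representatives and of all choices, whence THE. *)
definition Frac_comp ::
    "('o, 'm, 'x) uni_fractionable_category_scheme
     \<Rightarrow> 'm three_arrow set \<Rightarrow> 'm three_arrow set \<Rightarrow> 'm three_arrow set" where
  "Frac_comp C F G =
     (THE H. \<exists>X Y Z b1 f1 a1 b2 f2 a2 j q q' f1' j' f2'.
        (b1, f1, a1) \<in> three_arrows C X Y \<and> F = double_fraction C (b1, f1, a1) \<and>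
        (b2, f2, a2) \<in> three_arrows C Y Z \<and> G = double_fraction C (b2, f2, a2) \<and>
        j \<in> SDen C \<and> q \<in> TDen C \<and> Tgt C j = Src C q \<and> b2 \<cdot>\<^bsub>C\<^esub> a1 = j \<cdot>\<^bsub>C\<^esub> q \<and>
        q' \<in> TDen C \<and> Tgt C q' = Src C f1 \<and> f1' \<in> hom C (Src C q') (Src C q) \<and>
        f1' \<cdot>\<^bsub>C\<^esub> q = q' \<cdot>\<^bsub>C\<^esub> f1 \<and>
        j' \<in> SDen C \<and> Src C j' = Tgt C f2 \<and> f2' \<in> hom C (Tgt C j) (Tgt C j') \<and>
        j \<cdot>\<^bsub>C\<^esub> f2' = f2 \<cdot>\<^bsub>C\<^esub> j' \<and>
        H = double_fraction C (q' \<cdot>\<^bsub>C\<^esub> b1, f1' \<cdot>\<^bsub>C\<^esub> f2', a2 \<cdot>\<^bsub>C\<^esub> j'))"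

definition Frac ::
    "('o, 'm, 'x) uni_fractionable_category_scheme \<Rightarrow> ('o, 'm three_arrow set) category" where
  "Frac C =
     \<lparr>Obj = Obj C,
      Mor = {double_fraction C A |A X Y. A \<in> three_arrows C X Y},
      Src = (\<lambda>F. THE X. \<exists>Y. \<exists>A \<in> three_arrows C X Y. F = double_fraction C A),
      Tgt = (\<lambda>F. THE Y. \<exists>X. \<exists>A \<in> three_arrows C X Y. F = double_fraction C A),
      Idt = (\<lambda>X. double_fraction C (Idt C X, Idt C X, Idt C X)),
      Cmp = Frac_comp C\<rparr>"

end

theory Submission
  imports Defs
begin

text \<open>
  Parallel 3-arrows form a category whose morphisms are the commutative ladders with identities on
  the outside, and fraction equality is connectedness in this category. By weak universality and the
  factorisation axiom of \<open>C\<close>, it again has factorisations into S- and T-denominators, weak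
  pushouts of S-denominators and weak pullbacks of T-denominators; hence every zigzag of ladders
  reduces to one of the shape \<open>\<leftarrow>\<rightarrow>\<leftarrow>\<close> with a T-denominator on the left and an S-denominator on the right.
  This is part (a).

  For part (b), composites in \<open>Frac C\<close> may be computed with arbitrary denominators instead of
  S- and T-denominators (both define the same class), so that a 3-by-3 diagram exhibits the same 3-arrow
  as a representative of both composites. Conversely, the diagram of part (a) for two composites is
  turned into a 3-by-3 diagram by weak pullbacks along the T-denominators and weak pushouts along
  the S-denominators.
\<close>

section \<open>Duality and weak universality\<close>

context category
begin

lemma hom_iff: "f \<in> hom C X Y \<longleftrightarrow> f \<in> Mor C \<and> Src C f = X \<and> Tgt C f = Y"
  by (simp add: hom_def)

lemma comp_Mor [simp]:
    "\<lbrakk>f \<in> Mor C; g \<in> Mor C; Tgt C f = Src C g\<rbrakk> \<Longrightarrow> f \<cdot> g \<in> Mor C"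
  and Src_comp [simp]:
    "\<lbrakk>f \<in> Mor C; g \<in> Mor C; Tgt C f = Src C g\<rbrakk> \<Longrightarrow> Src C (f \<cdot> g) = Src C f"
  and Tgt_comp [simp]:
    "\<lbrakk>f \<in> Mor C; g \<in> Mor C; Tgt C f = Src C g\<rbrakk> \<Longrightarrow> Tgt C (f \<cdot> g) = Tgt C g"
  using Cmp_in_hom[of f "Src C f" "Tgt C f" g "Tgt C g"] by (auto simp: hom_iff)

lemma comp_assoc [simp]:
  "\<lbrakk>f \<in> Mor C; g \<in> Mor C; h \<in> Mor C; Tgt C f = Src C g; Tgt C g = Src C h\<rbrakk>
   \<Longrightarrow> (f \<cdot> g) \<cdot> h = f \<cdot> (g \<cdot> h)"
  by (rule Cmp_assoc) (auto simp: hom_iff)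

text \<open>Composites are kept nested to the right by \<open>comp_assoc\<close>, so an equation for
  \<open>f \<cdot> g\<close> no longer matches once a further factor \<open>k\<close> follows. The
  present form applies it there and carries most of the diagram chases below.\<close>

lemma comp_reassoc:
  "\<lbrakk>f \<cdot> g = h; f \<in> Mor C; g \<in> Mor C; k \<in> Mor C; Tgt C f = Src C g; Tgt C g = Src C k\<rbrakk>
   \<Longrightarrow> f \<cdot> (g \<cdot> k) = h \<cdot> k"
  by (metis comp_assoc)

lemma Idt_simps [simp]:
  assumes "X \<in> Obj C"
  shows "Idt C X \<in> Mor C" "Src C (Idt C X) = X" "Tgt C (Idt C X) = X"
  using Idt_in_hom[OF assms] by (auto simp: hom_iff)

lemma comp_Idt [simp]:
  assumes "f \<in> Mor C"
  shows "Src C f = X \<Longrightarrow> Idt C X \<cdot> f = f" "Tgt C f = Y \<Longrightarrow> f \<cdot> Idt C Y = f"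
  using assms Idt_left[of f "Src C f" "Tgt C f"] Idt_right[of f "Src C f" "Tgt C f"]
  by (auto simp: hom_iff)

end

text \<open>As a record update it keeps the record type, extension included, and is an involution on
  the nose. S- and T-denominators change places because weak pushouts become weak pullbacks.\<close>

definition dual ::
    "('o, 'm, 'x) uni_fractionable_category_scheme \<Rightarrow> ('o, 'm, 'x) uni_fractionable_category_scheme" where
  "dual C = C\<lparr>Src := Tgt C, Tgt := Src C, Cmp := \<lambda>f g. Cmp C g f, SDen := TDen C, TDen := SDen C\<rparr>"

lemma dual_simps [simp]:
  "Obj (dual C) = Obj C" "Mor (dual C) = Mor C" "Src (dual C) = Tgt C" "Tgt (dual C) = Src C"
  "Idt (dual C) = Idt C" "Cmp (dual C) f g = Cmp C g f" "Den (dual C) = Den C"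
  "SDen (dual C) = TDen C" "TDen (dual C) = SDen C"
  by (simp_all add: dual_def)

lemma hom_dual [simp]: "hom (dual C) X Y = hom C Y X"
  by (auto simp: hom_def)

lemma weak_pushout_dual: "weak_pushout (dual C) p f f' p' \<longleftrightarrow> weak_pullback C f p f' p'"
  by (auto simp: weak_pushout_def weak_pullback_def)

lemma weak_pullback_dual: "weak_pullback (dual C) f i f' i' \<longleftrightarrow> weak_pushout C i f f' i'"
  by (auto simp: weak_pushout_def weak_pullback_def)

lemma multiplicative_dual: "multiplicative (dual C) D \<longleftrightarrow> multiplicative C D"
  by (auto simp: multiplicative_def)

text \<open>The two halves of weak universality are exchanged, while semi-saturation and the
  factorisation axiom are self-dual. Interpreting the locale at \<open>dual C\<close> then provides
  the dual of a lemma already proved.\<close>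

lemma (in uni_fractionable_category) uni_fractionable_dual: "uni_fractionable_category (dual C)"
proof unfold_locales
  show "semi_saturated (dual C) (Den (dual C))"
    using semi_saturated_Den by (auto simp: semi_saturated_def multiplicative_dual)
  show "multiplicative (dual C) (SDen (dual C))" "multiplicative (dual C) (TDen (dual C))"
    using multiplicative_SDen multiplicative_TDen by (simp_all add: multiplicative_dual)
  show "\<exists>i\<in>SDen (dual C). \<exists>p\<in>TDen (dual C). Tgt (dual C) i = Src (dual C) p \<and> d = i \<cdot>\<^bsub>dual C\<^esub> p"
    if "d \<in> Den (dual C)" for d
    using factorisation[of d] that by simp metis
  show "(f \<cdot>\<^bsub>dual C\<^esub> g) \<cdot>\<^bsub>dual C\<^esub> h = f \<cdot>\<^bsub>dual C\<^esub> (g \<cdot>\<^bsub>dual C\<^esub> h)"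
    if "f \<in> hom (dual C) W X" "g \<in> hom (dual C) X Y" "h \<in> hom (dual C) Y Z" for f g h W X Y Z
    using that by (simp add: hom_iff)
  show "f \<cdot>\<^bsub>dual C\<^esub> g \<in> hom (dual C) X Z"
    if "f \<in> hom (dual C) X Y" "g \<in> hom (dual C) Y Z" for f g X Y Z
    using that by (simp add: hom_iff)
  show "\<exists>f' i'. weak_pushout (dual C) i f f' i' \<and> i' \<in> SDen (dual C)"
    if "i \<in> SDen (dual C)" "f \<in> Mor (dual C)" "Src (dual C) f = Src (dual C) i" for i f
    using weak_universality_TDen[of i f] that by (simp add: weak_pushout_dual)
  show "\<exists>f' p'. weak_pullback (dual C) f p f' p' \<and> p' \<in> TDen (dual C)"
    if "p \<in> TDen (dual C)" "f \<in> Mor (dual C)" "Tgt (dual C) f = Tgt (dual C) p" for p f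
    using weak_universality_SDen[of p f] that by (simp add: weak_pullback_dual)
  show "Idt (dual C) X \<in> hom (dual C) X X" if "X \<in> Obj (dual C)" for X
    using that by (simp add: hom_iff)
  show "Idt (dual C) X \<cdot>\<^bsub>dual C\<^esub> f = f" "f \<cdot>\<^bsub>dual C\<^esub> Idt (dual C) Y = f"
    if "f \<in> hom (dual C) X Y" for f X Y
    using that by (simp_all add: hom_iff)
qed (use Src_in_Obj Tgt_in_Obj Den_subset_Mor SDen_subset_Den TDen_subset_Den in simp_all)

section \<open>Denominators, factorisations and weak universal squares\<close>

context uni_fractionable_category
begin

lemma Den_Mor [simp]: "f \<in> Den C \<Longrightarrow> f \<in> Mor C"
  using Den_subset_Mor by auto

lemma SDen_Den [simp]: "f \<in> SDen C \<Longrightarrow> f \<in> Den C"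
  using SDen_subset_Den by auto

lemma TDen_Den [simp]: "f \<in> TDen C \<Longrightarrow> f \<in> Den C"
  using TDen_subset_Den by auto

lemma Idt_denominators [simp]:
  "X \<in> Obj C \<Longrightarrow> Idt C X \<in> Den C"
  "X \<in> Obj C \<Longrightarrow> Idt C X \<in> SDen C"
  "X \<in> Obj C \<Longrightarrow> Idt C X \<in> TDen C"
  using semi_saturated_Den multiplicative_SDen multiplicative_TDen
  unfolding semi_saturated_def multiplicative_def by blast+

lemma comp_denominators [simp]:
  "\<lbrakk>f \<in> Den C; g \<in> Den C; Tgt C f = Src C g\<rbrakk> \<Longrightarrow> f \<cdot> g \<in> Den C"
  "\<lbrakk>f \<in> SDen C; g \<in> SDen C; Tgt C f = Src C g\<rbrakk> \<Longrightarrow> f \<cdot> g \<in> SDen C"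
  "\<lbrakk>f \<in> TDen C; g \<in> TDen C; Tgt C f = Src C g\<rbrakk> \<Longrightarrow> f \<cdot> g \<in> TDen C"
  using semi_saturated_Den multiplicative_SDen multiplicative_TDen
  unfolding semi_saturated_def multiplicative_def by blast+

lemma Den_cancel:
  assumes "f \<in> Mor C" "g \<in> Mor C" "Tgt C f = Src C g" "f \<cdot> g \<in> Den C"
  shows "f \<in> Den C \<Longrightarrow> g \<in> Den C" "g \<in> Den C \<Longrightarrow> f \<in> Den C"
  using semi_saturated_Den[unfolded semi_saturated_def, THEN conjunct2, rule_format, OF assms(1-3)]
    assms(4)
  by blast+

lemma factorE:
  assumes "d \<in> Den C"
  obtains i p where "i \<in> SDen C" "p \<in> TDen C" "Src C i = Src C d"
    "Src C p = Tgt C i" "Tgt C p = Tgt C d" "i \<cdot> p = d"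
proof -
  obtain i p where ip: "i \<in> SDen C" "p \<in> TDen C" "Tgt C i = Src C p" "d = i \<cdot> p"
    using factorisation[OF assms] by blast
  show ?thesis
    by (rule that[of i p]) (simp_all add: ip)
qed

lemma weak_pushoutD:
  assumes "weak_pushout C i f h k"
  shows "i \<in> Mor C" "f \<in> Mor C" "h \<in> Mor C" "k \<in> Mor C" "Src C f = Src C i"
    "Src C h = Tgt C i" "Src C k = Tgt C f" "Tgt C k = Tgt C h" "i \<cdot> h = f \<cdot> k"
  using assms unfolding weak_pushout_def hom_def by auto

lemma weak_pushout_induced:
  assumes "weak_pushout C i f h k" "u \<in> Mor C" "v \<in> Mor C"
    "Src C u = Tgt C i" "Src C v = Tgt C f" "Tgt C u = Tgt C v" "i \<cdot> u = f \<cdot> v"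
  obtains w where "w \<in> Mor C" "Src C w = Tgt C h" "Tgt C w = Tgt C v" "h \<cdot> w = u" "k \<cdot> w = v"
proof -
  have "\<exists>w \<in> hom C (Tgt C h) (Tgt C v). h \<cdot> w = u \<and> k \<cdot> w = v"
    using assms unfolding weak_pushout_def hom_def by blast
  then show thesis using that by (auto simp: hom_iff)
qed

lemma pushoutE:
  assumes "i \<in> SDen C" "f \<in> Mor C" "Src C f = Src C i"
  obtains h k where "weak_pushout C i f h k" "k \<in> SDen C"
  using weak_universality_SDen assms by blast

lemma weak_pullbackD:
  assumes "weak_pullback C f p h k"
  shows "p \<in> Mor C" "f \<in> Mor C" "h \<in> Mor C" "k \<in> Mor C" "Tgt C f = Tgt C p"
    "Tgt C h = Src C p" "Tgt C k = Src C f" "Src C k = Src C h" "h \<cdot> p = k \<cdot> f"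
  using assms unfolding weak_pullback_def hom_def by auto

lemma weak_pullback_induced:
  assumes "weak_pullback C f p h k" "u \<in> Mor C" "v \<in> Mor C"
    "Tgt C u = Src C p" "Tgt C v = Src C f" "Src C u = Src C v" "u \<cdot> p = v \<cdot> f"
  obtains w where "w \<in> Mor C" "Tgt C w = Src C h" "Src C w = Src C v" "w \<cdot> h = u" "w \<cdot> k = v"
proof -
  have "\<exists>w \<in> hom C (Src C v) (Src C h). w \<cdot> h = u \<and> w \<cdot> k = v"
    using assms unfolding weak_pullback_def hom_def by blast
  then show thesis using that by (auto simp: hom_iff)
qed

lemma pullbackE:
  assumes "p \<in> TDen C" "f \<in> Mor C" "Tgt C f = Tgt C p"
  obtains h k where "weak_pullback C f p h k" "k \<in> TDen C"
  using weak_universality_TDen assms by blast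

end

section \<open>Ladders between parallel 3-arrows\<close>

text \<open>The columns \<open>c\<close> and \<open>e\<close> are only required to be morphisms;
  that they are denominators is derived in \<open>ladder_iff\<close>.\<close>

fun ladder :: "('o, 'm, 'x) den_category_scheme
    \<Rightarrow> 'm three_arrow \<Rightarrow> 'm \<times> 'm \<Rightarrow> 'm three_arrow \<Rightarrow> bool" where
  "ladder C (b, f, a) (c, e) (b', f', a') \<longleftrightarrow>
     (\<exists>X Y. (b, f, a) \<in> three_arrows C X Y \<and> (b', f', a') \<in> three_arrows C X Y) \<and>
     c \<in> hom C (Src C f) (Src C f') \<and> e \<in> hom C (Tgt C f) (Tgt C f') \<and>
     c \<cdot>\<^bsub>C\<^esub> b' = b \<and> f \<cdot>\<^bsub>C\<^esub> e = c \<cdot>\<^bsub>C\<^esub> f' \<and> a \<cdot>\<^bsub>C\<^esub> e = a'"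

declare ladder.simps [simp del]

context uni_fractionable_category
begin

lemma three_arrows_iff:
  "(b, f, a) \<in> three_arrows C X Y \<longleftrightarrow>
     b \<in> Den C \<and> f \<in> Mor C \<and> a \<in> Den C \<and>
     Src C b = Src C f \<and> Tgt C b = X \<and> Src C a = Y \<and> Tgt C a = Tgt C f"
  by (auto simp: three_arrows_def hom_iff)

lemma normal_three_arrows_iff:
  "(b, f, a) \<in> normal_three_arrows C X Y \<longleftrightarrow>
     (b, f, a) \<in> three_arrows C X Y \<and> b \<in> TDen C \<and> a \<in> SDen C"
  by (auto simp: normal_three_arrows_def)

text \<open>Semi-saturation, applied to \<open>c \<cdot> b' = b\<close> and
  \<open>a \<cdot> e = a'\<close>, makes both columns denominators. The typing conditions are listed
  flatly for the simplifier.\<close>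

lemma ladder_iff:
  "ladder C (b, f, a) (c, e) (b', f', a') \<longleftrightarrow>
     b \<in> Den C \<and> f \<in> Mor C \<and> a \<in> Den C \<and> b' \<in> Den C \<and> f' \<in> Mor C \<and> a' \<in> Den C \<and>
     Src C b = Src C f \<and> Tgt C a = Tgt C f \<and> Src C b' = Src C f' \<and> Tgt C a' = Tgt C f' \<and>
     Tgt C b' = Tgt C b \<and> Src C a' = Src C a \<and>
     c \<in> Den C \<and> e \<in> Den C \<and> Src C c = Src C f \<and> Tgt C c = Src C f' \<and>
     Src C e = Tgt C f \<and> Tgt C e = Tgt C f' \<and>
     c \<cdot> b' = b \<and> f \<cdot> e = c \<cdot> f' \<and> a \<cdot> e = a'" (is "?L \<longleftrightarrow> ?R")
proof
  assume L: ?L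
  then have "c \<in> Mor C" "e \<in> Mor C" "b' \<in> Den C" "a \<in> Den C" "c \<cdot> b' \<in> Den C" "a \<cdot> e \<in> Den C"
    "Tgt C c = Src C b'" "Tgt C a = Src C e"
    by (auto simp: ladder.simps three_arrows_iff hom_iff)
  then have "c \<in> Den C" "e \<in> Den C"
    using Den_cancel(2)[of c b'] Den_cancel(1)[of a e] by simp_all
  with L show ?R
    by (auto simp: ladder.simps three_arrows_iff hom_iff)
qed (auto simp: ladder.simps three_arrows_iff hom_iff)

lemma ladder_refl:
  assumes "A \<in> three_arrows C X Y"
  obtains U V where "U \<in> Obj C" "V \<in> Obj C" "ladder C A (Idt C U, Idt C V) A"
proof -
  obtain b f a where A: "A = (b, f, a)" by (metis prod_cases3)
  show ?thesis
    by (rule that[of "Src C f" "Tgt C f"])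
      (use assms Src_in_Obj[of f] Tgt_in_Obj[of f] in \<open>auto simp: A ladder_iff three_arrows_iff\<close>)
qed

lemma ladder_comp:
  assumes "ladder C A (c, e) B" "ladder C B (c', e') D"
  shows "ladder C A (c \<cdot> c', e \<cdot> e') D"
proof -
  obtain b f a b' f' a' b'' f'' a'' where [simp]: "A = (b, f, a)" "B = (b', f', a')" "D = (b'', f'', a'')"
    by (metis prod_cases3)
  note facts = assms[simplified this ladder_iff]
  have "f \<cdot> (e \<cdot> e') = c \<cdot> (c' \<cdot> f'')"
    using facts comp_reassoc[of f e "c \<cdot> f'" e'] by simp
  moreover have "a \<cdot> (e \<cdot> e') = a''"
    using facts comp_reassoc[of a e a' e'] by simp
  ultimately show ?thesis
    using facts by (simp add: ladder_iff)
qed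

text \<open>The generators leave the outer objects alone, and \<open>c\<close> is a denominator by
  semi-saturation. As an equivalence the claim passes through symmetry without further work.\<close>

lemma fraction_equal_three_arrows:
  "fraction_equal C A B \<Longrightarrow> A \<in> three_arrows C X Y \<longleftrightarrow> B \<in> three_arrows C X Y"
proof (induction rule: fraction_equal.induct)
  case (right b f a X' Y' c)
  then have "c \<in> Den C" using Den_cancel(1)[of a c] by (simp add: three_arrows_iff)
  with right show ?case by (auto simp: three_arrows_iff)
next
  case (left b f a X' Y' c)
  then have "c \<in> Den C" using Den_cancel(2)[of c b] by (simp add: three_arrows_iff)
  with left show ?case by (auto simp: three_arrows_iff)
qed auto

text \<open>The two generators meet in the middle: enlarging \<open>A\<close> on the right by
  \<open>e\<close> and \<open>B\<close> on the left by \<open>c\<close> gives the same 3-arrow,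
  since \<open>f \<cdot> e = c \<cdot> f'\<close>.\<close>

lemma ladder_imp_fraction_equal:
  assumes "ladder C A (c, e) B"
  shows "fraction_equal C A B"
proof -
  obtain b f a b' f' a' where [simp]: "A = (b, f, a)" "B = (b', f', a')"
    by (metis prod_cases3)
  note facts = assms[simplified ladder_iff this]
  have "fraction_equal C (b, f, a) (b, f \<cdot> e, a \<cdot> e)"
    by (rule fraction_equal.right[where X = "Tgt C b" and Y = "Src C a"])
      (use facts in \<open>auto simp: three_arrows_iff\<close>)
  moreover have "fraction_equal C (b', f', a') (c \<cdot> b', c \<cdot> f', a')"
    by (rule fraction_equal.left[where X = "Tgt C b'" and Y = "Src C a'"])
      (use facts in \<open>auto simp: three_arrows_iff\<close>)
  ultimately show ?thesis
    using facts by (auto intro: fraction_equal.sym fraction_equal.trans)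
qed

text \<open>Induction along a zigzag of ladders starting at \<open>A\<close>; each generator of
  fraction equality is a ladder with an identity as one column.\<close>

lemma fraction_equal_induct [consumes 1, case_names refl forward backward]:
  assumes "fraction_equal C A B"
    and "\<And>X Y. A \<in> three_arrows C X Y \<Longrightarrow> P A"
    and "\<And>B c e D. \<lbrakk>P B; ladder C B (c, e) D\<rbrakk> \<Longrightarrow> P D"
    and "\<And>B c e D. \<lbrakk>P B; ladder C D (c, e) B\<rbrakk> \<Longrightarrow> P D"
  shows "P B"
proof -
  \<comment> \<open>This is itself an equivalence relation in \<open>A\<close> and \<open>B\<close>,
    so only the two generators need an argument.\<close>
  have "P A \<longleftrightarrow> P B"
    using assms(1)
  proof (induction rule: fraction_equal.induct)
    case (right b f a X' Y' c)
    then have "c \<in> Den C" using Den_cancel(1)[of a c] by (simp add: three_arrows_iff)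
    with right have "ladder C (b, f, a) (Idt C (Src C f), c) (b, f \<cdot> c, a \<cdot> c)"
      using Src_in_Obj[of f] by (auto simp: three_arrows_iff ladder_iff)
    then show ?case using assms(3,4) by blast
  next
    case (left b f a X' Y' c)
    then have "c \<in> Den C" using Den_cancel(2)[of c b] by (simp add: three_arrows_iff)
    with left have "ladder C (c \<cdot> b, c \<cdot> f, a) (c, Idt C (Tgt C f)) (b, f, a)"
      using Tgt_in_Obj[of f] by (auto simp: three_arrows_iff ladder_iff)
    then show ?case using assms(3,4) by blast
  qed auto
  moreover have "\<exists>X Y. A \<in> three_arrows C X Y"
    using assms(1) by (induction rule: fraction_equal.induct) (metis fraction_equal_three_arrows fraction_equal.intros)+
  ultimately show ?thesis using assms(2) by blast
qed

lemma double_fraction_eq_iff: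
  assumes "A \<in> three_arrows C X Y"
  shows "double_fraction C A = double_fraction C B \<longleftrightarrow> fraction_equal C A B"
proof
  assume "double_fraction C A = double_fraction C B"
  moreover have "A \<in> double_fraction C A"
    using assms by (auto simp: double_fraction_def intro: fraction_equal.refl)
  ultimately show "fraction_equal C A B"
    by (auto simp: double_fraction_def intro: fraction_equal.sym)
next
  assume "fraction_equal C A B"
  then show "double_fraction C A = double_fraction C B"
    by (auto simp: double_fraction_def intro: fraction_equal.sym fraction_equal.trans)
qed

text \<open>Factor the left column as \<open>i \<cdot> p\<close> and push \<open>f\<close> out along
  \<open>i\<close>. This splits the right column \<open>e\<close> as \<open>k \<cdot> w\<close>, and
  factoring \<open>w\<close> as \<open>j \<cdot> q\<close> gives it the S-part
  \<open>k \<cdot> j\<close> and the T-part \<open>q\<close>.\<close>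

lemma ladder_factor:
  assumes "ladder C A (c, e) B"
  obtains D i i' p p' where "i \<in> SDen C" "i' \<in> SDen C" "p \<in> TDen C" "p' \<in> TDen C"
    "ladder C A (i, i') D" "ladder C D (p, p') B"
proof -
  obtain b f a b' f' a' where [simp]: "A = (b, f, a)" "B = (b', f', a')"
    by (metis prod_cases3)
  note facts = assms[simplified ladder_iff this]
  have c: "c \<in> Den C" using facts by simp
  obtain i p where ip: "i \<in> SDen C" "p \<in> TDen C" "Src C i = Src C c"
    "Src C p = Tgt C i" "Tgt C p = Tgt C c" "i \<cdot> p = c"
    by (rule factorE[OF c])
  have f: "f \<in> Mor C" "Src C f = Src C i" using facts ip by simp_all
  obtain h k where po: "weak_pushout C i f h k" "k \<in> SDen C"
    by (rule pushoutE[OF ip(1) f])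
  note hk = weak_pushoutD[OF po(1)]
  obtain w where w: "w \<in> Mor C" "Src C w = Tgt C h" "Tgt C w = Tgt C e" "h \<cdot> w = p \<cdot> f'" "k \<cdot> w = e"
    by (rule weak_pushout_induced[OF po(1), of "p \<cdot> f'" e])
      (use facts ip in \<open>simp_all add: comp_reassoc[OF ip(6)]\<close>)
  have "w \<in> Den C"
    using Den_cancel(1)[of k w] w hk po facts by simp
  then obtain j q where jq: "j \<in> SDen C" "q \<in> TDen C" "Src C j = Src C w"
    "Src C q = Tgt C j" "Tgt C q = Tgt C w" "j \<cdot> q = w"
    by (rule factorE)
  have 1: "i \<cdot> (p \<cdot> b') = b"
    using comp_reassoc[of i p c b'] ip facts by simp
  have 2: "i \<cdot> (h \<cdot> j) = f \<cdot> (k \<cdot> j)"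
    using comp_reassoc[of i h "f \<cdot> k" j] hk ip jq w facts by simp
  have 3: "k \<cdot> (j \<cdot> q) = e" "h \<cdot> (j \<cdot> q) = p \<cdot> f'"
    using w jq by simp_all
  show ?thesis
    by (rule that[of i "k \<cdot> j" p q "(p \<cdot> b', h \<cdot> j, a \<cdot> (k \<cdot> j))"])
      (use facts ip po hk w jq 1 2 3 in \<open>simp_all add: ladder_iff\<close>)
qed

end

section \<open>Reduction of zigzags\<close>

fun dual_three_arrow :: "'m three_arrow \<Rightarrow> 'm three_arrow" where
  "dual_three_arrow (b, f, a) = (a, f, b)"

lemma dual_three_arrow_involution [simp]: "dual_three_arrow (dual_three_arrow A) = A"
  by (cases A) simp

lemma dual_three_arrow_sel [simp]:
  "fst (dual_three_arrow A) = snd (snd A)" "snd (snd (dual_three_arrow A)) = fst A"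
  by (cases A; simp)+

text \<open>Carries statements on S-ladders over to T-ladders. The columns trade places because the
  two outer denominators of a 3-arrow do.\<close>

lemma ladder_dual:
  "ladder (dual C) (dual_three_arrow A) (e, c) (dual_three_arrow B) \<longleftrightarrow> ladder C B (c, e) A"
  by (cases A; cases B) (auto simp: ladder.simps three_arrows_def)

context uni_fractionable_category
begin

text \<open>The squares are weak pushouts, formed column by column. The left one induces the left
  denominator and the row of \<open>E\<close>; semi-saturation makes the new vertical morphisms
  denominators.\<close>

lemma ladder_pushout:
  assumes A: "ladder C A (i, j) B" "i \<in> SDen C" "j \<in> SDen C" and D: "ladder C A (c, e) D"
  obtains E i' j' c' e' where "i' \<in> SDen C" "j' \<in> SDen C" "ladder C D (i', j') E" "ladder C B (c', e') E"
proof -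
  obtain b f a b1 f1 a1 b2 f2 a2 where [simp]: "A = (b, f, a)" "B = (b1, f1, a1)" "D = (b2, f2, a2)"
    by (metis prod_cases3)
  note AB = A[simplified ladder_iff this] and AD = D[simplified ladder_iff this]
  obtain h k where po: "weak_pushout C i c h k" "k \<in> SDen C"
    by (rule pushoutE[of i c]) (use AB AD in simp_all)
  obtain h' k' where po': "weak_pushout C j e h' k'" "k' \<in> SDen C"
    by (rule pushoutE[of j e]) (use AB AD in simp_all)
  note hk = weak_pushoutD[OF po(1)] and hk' = weak_pushoutD[OF po'(1)]
  obtain b' where b': "b' \<in> Mor C" "Src C b' = Tgt C h" "Tgt C b' = Tgt C b2"
      "h \<cdot> b' = b1" "k \<cdot> b' = b2"
    by (rule weak_pushout_induced[OF po(1), of b1 b2]) (use AB AD in simp_all)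
  \<comment> \<open>Both sides equal \<open>f\<close> followed by the diagonal
    \<open>j \<cdot> h' = e \<cdot> k'\<close> of the right column's square.\<close>
  have eq: "i \<cdot> (f1 \<cdot> h') = c \<cdot> (f2 \<cdot> k')"
    using comp_reassoc[of f j "i \<cdot> f1" h'] comp_reassoc[of f e "c \<cdot> f2" k'] AB AD hk' by simp
  obtain f' where f': "f' \<in> Mor C" "Src C f' = Tgt C h" "Tgt C f' = Tgt C (f2 \<cdot> k')"
      "h \<cdot> f' = f1 \<cdot> h'" "k \<cdot> f' = f2 \<cdot> k'"
    by (rule weak_pushout_induced[OF po(1), of "f1 \<cdot> h'" "f2 \<cdot> k'", OF _ _ _ _ _ eq])
      (use AB AD hk' in simp_all)
  have "b' \<in> Den C" "h \<in> Den C" "h' \<in> Den C"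
    using Den_cancel(1)[of k b'] Den_cancel(1)[of i h] Den_cancel(1)[of j h'] b' hk hk' po po' AB AD
    by simp_all
  moreover have "a1 \<cdot> h' = a2 \<cdot> k'"
    using comp_reassoc[of a j a1 h'] comp_reassoc[of a e a2 k'] AB AD hk' by simp
  ultimately show ?thesis
    by (intro that[of k k' "(b', f', a2 \<cdot> k')" h h'])
      (use AB AD po po' hk hk' b' f' in \<open>simp_all add: ladder_iff\<close>)
qed

lemma ladder_pullback:
  assumes "ladder C B (p, q) A" "p \<in> TDen C" "q \<in> TDen C" "ladder C D (c, e) A"
  obtains E p' q' c' e' where "p' \<in> TDen C" "q' \<in> TDen C" "ladder C E (p', q') D" "ladder C E (c', e') B"
proof -
  interpret D: uni_fractionable_category "dual C" by (rule uni_fractionable_dual)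
  show ?thesis
  proof (rule D.ladder_pushout[of "dual_three_arrow A" q p "dual_three_arrow B" e c "dual_three_arrow D"])
    fix E i' j' c' e'
    assume "i' \<in> SDen (dual C)" "j' \<in> SDen (dual C)"
      "ladder (dual C) (dual_three_arrow D) (i', j') E" "ladder (dual C) (dual_three_arrow B) (c', e') E"
    then show thesis
      using that[of j' i' "dual_three_arrow E" e' c'] ladder_dual[of C D i' j' "dual_three_arrow E"]
        ladder_dual[of C B c' e' "dual_three_arrow E"] by simp
  qed (use assms in \<open>simp_all add: ladder_dual\<close>)
qed

text \<open>A ladder leaving \<open>B\<close> is pushed out along the S-ladder from \<open>B\<close>
  to \<open>E\<close>. A ladder arriving at \<open>B\<close> is composed with that S-ladder and
  factored into an S-ladder to some \<open>W\<close> and a T-ladder from \<open>W\<close> to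
  \<open>E\<close>; the latter is pulled back along the ladder from \<open>D\<close> to
  \<open>E\<close>.\<close>

lemma fraction_equal_imp_zigzag:
  assumes "fraction_equal C A B"
  shows "\<exists>D E p p' d d' i i'. p \<in> TDen C \<and> p' \<in> TDen C \<and> i \<in> SDen C \<and> i' \<in> SDen C \<and>
    ladder C D (p, p') A \<and> ladder C D (d, d') E \<and> ladder C B (i, i') E"
  using assms
proof (induction rule: fraction_equal_induct)
  case (refl X Y)
  then show ?case
    by (rule ladder_refl) (use Idt_denominators in blast)
next
  case (forward B c e B')
  then obtain D E p p' d d' i i' where
    "p \<in> TDen C" "p' \<in> TDen C" "ladder C D (p, p') A" "ladder C D (d, d') E"
    and i: "i \<in> SDen C" "i' \<in> SDen C" "ladder C B (i, i') E" by blast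
  moreover obtain E' j j' c' e' where "j \<in> SDen C" "j' \<in> SDen C"
    "ladder C B' (j, j') E'" "ladder C E (c', e') E'"
    by (rule ladder_pushout[OF i(3,1,2) forward(2)])
  ultimately show ?case
    using ladder_comp by blast
next
  case (backward B c e B')
  then obtain D E p p' d d' i i' where
    p: "p \<in> TDen C" "p' \<in> TDen C" "ladder C D (p, p') A" and d: "ladder C D (d, d') E"
    and i: "i \<in> SDen C" "i' \<in> SDen C" "ladder C B (i, i') E" by blast
  obtain W j j' q q' where j: "j \<in> SDen C" "j' \<in> SDen C" "ladder C B' (j, j') W"
    and q: "q \<in> TDen C" "q' \<in> TDen C" "ladder C W (q, q') E"
    by (rule ladder_factor[OF ladder_comp[OF backward(2) i(3)]])
  obtain D' r r' c' e' where r: "r \<in> TDen C" "r' \<in> TDen C" "ladder C D' (r, r') D"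
      "ladder C D' (c', e') W"
    by (rule ladder_pullback[OF q(3,1,2) d])
  have "Tgt C r = Src C p" "Tgt C r' = Src C p'"
    using p(3) r(3) by (cases A; cases D; cases D'; simp add: ladder_iff)+
  then have "r \<cdot> p \<in> TDen C" "r' \<cdot> p' \<in> TDen C"
    using p r by simp_all
  with ladder_comp[OF r(3) p(3)] j r(4) show ?case by blast
qed

text \<open>The left denominator of \<open>D\<close> is \<open>p \<cdot> b\<close>, already a
  T-denominator. The T-part \<open>q\<close> of the right one is moved across the row by a weak
  pullback, which leaves the S-part \<open>j\<close> on the right.\<close>

lemma normalise_source:
  assumes AB: "ladder C D (p, p') A" "p \<in> TDen C" "p' \<in> TDen C" and A: "fst A \<in> TDen C"
  obtains E q q' where "q \<in> TDen C" "q' \<in> TDen C" "ladder C E (q, q') D"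
    "E \<in> normal_three_arrows C (Tgt C (fst A)) (Src C (snd (snd A)))"
proof -
  obtain b f a b1 f1 a1 where [simp]: "A = (b, f, a)" "D = (b1, f1, a1)"
    by (metis prod_cases3)
  note facts = assms[simplified ladder_iff this fst_conv]
  obtain j q where jq: "j \<in> SDen C" "q \<in> TDen C" "Src C j = Src C a1"
    "Src C q = Tgt C j" "Tgt C q = Tgt C a1" "j \<cdot> q = a1"
    by (rule factorE[of a1]) (use facts in simp_all)
  obtain h k where pb: "weak_pullback C f1 q h k" "k \<in> TDen C"
    by (rule pullbackE[of q f1]) (use facts jq in simp_all)
  note hk = weak_pullbackD[OF pb(1)]
  have "b1 \<in> TDen C"
    using facts comp_denominators(3)[of p b] by simp
  then show ?thesis
    by (intro that[of k q "(k \<cdot> b1, h, j)"])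
      (use facts jq pb hk in \<open>simp_all add: ladder_iff normal_three_arrows_iff three_arrows_iff\<close>)
qed

lemma normalise_target:
  assumes "ladder C A (i, i') D" "i \<in> SDen C" "i' \<in> SDen C" "snd (snd A) \<in> SDen C"
  obtains E j j' where "j \<in> SDen C" "j' \<in> SDen C" "ladder C D (j, j') E"
    "E \<in> normal_three_arrows C (Tgt C (fst A)) (Src C (snd (snd A)))"
proof -
  interpret D: uni_fractionable_category "dual C" by (rule uni_fractionable_dual)
  show ?thesis
  proof (rule D.normalise_source[of "dual_three_arrow D" i' i "dual_three_arrow A"])
    fix E q q'
    assume E: "q \<in> TDen (dual C)" "q' \<in> TDen (dual C)" "ladder (dual C) E (q, q') (dual_three_arrow D)"
      "E \<in> normal_three_arrows (dual C) (Tgt (dual C) (fst (dual_three_arrow A)))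
        (Src (dual C) (snd (snd (dual_three_arrow A))))"
    moreover have "dual_three_arrow E \<in> normal_three_arrows C (Tgt C (fst A)) (Src C (snd (snd A)))"
      using E(4) by (cases E)
        (auto simp: normal_three_arrows_iff three_arrows_iff D.normal_three_arrows_iff D.three_arrows_iff)
    ultimately show thesis
      using that[of q' q "dual_three_arrow E"] ladder_dual[of C "dual_three_arrow E" q q' D] by simp
  qed (use assms in \<open>simp_all add: ladder_dual\<close>)
qed

end

section \<open>Composition with arbitrary denominators\<close>

text \<open>The factors of a composite of two 3-arrows with middle parts \<open>f1\<close>, \<open>f2\<close> and \<open>d = b2 \<cdot> a1\<close>.
  In contrast to \<^const>\<open>Frac_comp\<close>, the letters \<open>s\<close>, \<open>t\<close>, \<open>v\<close>, \<open>w\<close> for \<open>j\<close>, \<open>q\<close>, \<open>q'\<close>, \<open>j'\<close>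
  range over all denominators, which makes composites stable under ladders.\<close>

definition composition_data :: "('o, 'm, 'x) den_category_scheme
    \<Rightarrow> 'm \<Rightarrow> 'm \<Rightarrow> 'm \<Rightarrow> 'm \<Rightarrow> 'm \<Rightarrow> 'm \<Rightarrow> 'm \<Rightarrow> 'm \<Rightarrow> 'm \<Rightarrow> bool" where
  "composition_data C f1 d f2 s t v h g w \<longleftrightarrow>
     s \<in> Den C \<and> t \<in> Den C \<and> v \<in> Den C \<and> w \<in> Den C \<and> h \<in> Mor C \<and> g \<in> Mor C \<and>
     f1 \<in> Mor C \<and> f2 \<in> Mor C \<and>
     Src C s = Src C f2 \<and> Src C t = Tgt C s \<and> Tgt C t = Tgt C f1 \<and>
     Src C v = Src C h \<and> Tgt C v = Src C f1 \<and> Tgt C h = Tgt C s \<and>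
     Src C w = Tgt C f2 \<and> Tgt C w = Tgt C g \<and> Src C g = Tgt C s \<and>
     s \<cdot>\<^bsub>C\<^esub> t = d \<and> h \<cdot>\<^bsub>C\<^esub> t = v \<cdot>\<^bsub>C\<^esub> f1 \<and> s \<cdot>\<^bsub>C\<^esub> g = f2 \<cdot>\<^bsub>C\<^esub> w"

definition composite :: "('o, 'm, 'x) den_category_scheme
    \<Rightarrow> 'm three_arrow \<Rightarrow> 'm three_arrow \<Rightarrow> 'm three_arrow \<Rightarrow> bool" where
  "composite C A B D \<longleftrightarrow>
     (case A of (b1, f1, a1) \<Rightarrow> case B of (b2, f2, a2) \<Rightarrow>
        \<exists>s t v h g w. composition_data C f1 (b2 \<cdot>\<^bsub>C\<^esub> a1) f2 s t v h g w \<and>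
          D = (v \<cdot>\<^bsub>C\<^esub> b1, h \<cdot>\<^bsub>C\<^esub> g, a2 \<cdot>\<^bsub>C\<^esub> w))"

lemma compositeI:
  "composition_data C f1 (b2 \<cdot>\<^bsub>C\<^esub> a1) f2 s t v h g w \<Longrightarrow>
     composite C (b1, f1, a1) (b2, f2, a2) (v \<cdot>\<^bsub>C\<^esub> b1, h \<cdot>\<^bsub>C\<^esub> g, a2 \<cdot>\<^bsub>C\<^esub> w)"
  unfolding composite_def prod.case by blast

text \<open>The conditions are self-dual: the factors of \<open>d\<close> change places, and so do
  the square over \<open>f1\<close> and the square under \<open>f2\<close>.\<close>

lemma composition_data_dual:
  "composition_data C f1 d f2 s t v h g w \<Longrightarrow> composition_data (dual C) f2 d f1 t s w g h v"
  by (auto simp: composition_data_def)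

lemma composite_dual:
  "composite C A B D \<Longrightarrow>
     composite (dual C) (dual_three_arrow B) (dual_three_arrow A) (dual_three_arrow D)"
  by (cases A; cases B) (use composition_data_dual in \<open>fastforce simp: composite_def\<close>)

lemma three_arrows_dual:
  "A \<in> three_arrows C X Y \<Longrightarrow> dual_three_arrow A \<in> three_arrows (dual C) Y X"
  by (cases A) (auto simp: three_arrows_def)

text \<open>The two generators are exchanged. One direction suffices because dualising is an
  involution.\<close>

lemma fraction_equal_dual:
  "fraction_equal C A B \<Longrightarrow> fraction_equal (dual C) (dual_three_arrow A) (dual_three_arrow B)"
proof (induction rule: fraction_equal.induct)
  case (right b f a X Y c)
  then show ?case
    using fraction_equal.left[of a f b "dual C" Y X c] three_arrows_dual[of "(b, f, a)" C X Y] by simp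
next
  case (left b f a X Y c)
  then show ?case
    using fraction_equal.right[of a f b "dual C" Y X c] three_arrows_dual[of "(b, f, a)" C X Y] by simp
next
  case (refl A X Y)
  then show ?case by (meson three_arrows_dual fraction_equal.refl)
qed (blast intro: fraction_equal.sym fraction_equal.trans)+

lemma dual_dual [simp]: "dual (dual C) = C"
  by (simp add: dual_def)

section \<open>Independence of composites from the chosen factors\<close>

context uni_fractionable_category
begin

lemma composition_data_exists:
  assumes "d \<in> Den C" "f1 \<in> Mor C" "f2 \<in> Mor C" "Src C d = Src C f2" "Tgt C d = Tgt C f1"
  obtains s t v h g w where "composition_data C f1 d f2 s t v h g w"
    "s \<in> SDen C" "t \<in> TDen C" "v \<in> TDen C" "w \<in> SDen C"
proof -
  obtain s t where st: "s \<in> SDen C" "t \<in> TDen C" "Src C s = Src C d"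
    "Src C t = Tgt C s" "Tgt C t = Tgt C d" "s \<cdot> t = d"
    by (rule factorE[OF assms(1)])
  obtain h v where hv: "weak_pullback C f1 t h v" "v \<in> TDen C"
    by (rule pullbackE[of t f1]) (use assms st in simp_all)
  obtain g w where gw: "weak_pushout C s f2 g w" "w \<in> SDen C"
    by (rule pushoutE[of s f2]) (use assms st in simp_all)
  show ?thesis
    by (rule that[of s t v h g w])
      (use assms st hv gw weak_pullbackD[OF hv(1)] weak_pushoutD[OF gw(1)] in
        \<open>simp_all add: composition_data_def\<close>)
qed

text \<open>Weak universality offers no weak pullback along the arbitrary denominator
  \<open>t\<close>, so \<open>t\<close> is factored as \<open>i \<cdot> p\<close>. With the weak
  pullback of \<open>f1\<close> along \<open>p\<close> and the weak pushout of \<open>g\<close>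
  along \<open>i\<close>, every admissible pair \<open>v\<close>, \<open>h\<close> has a ladder to
  one common 3-arrow.\<close>

lemma composition_data_left_unique:
  assumes "composition_data C f1 d f2 s t v h g w" "composition_data C f1 d f2 s t v' h' g w"
    and ba: "b \<in> Den C" "Src C b = Src C f1" "a \<in> Den C" "Tgt C a = Tgt C f2"
  shows "fraction_equal C (v \<cdot> b, h \<cdot> g, a \<cdot> w) (v' \<cdot> b, h' \<cdot> g, a \<cdot> w)"
proof -
  have t: "t \<in> Den C" "Src C t = Tgt C s" "Tgt C t = Tgt C f1" and f1: "f1 \<in> Mor C"
    and g: "g \<in> Mor C" "Src C g = Tgt C s"
    using assms(1) by (simp_all add: composition_data_def)
  obtain i p where ip: "i \<in> SDen C" "p \<in> TDen C" "Src C i = Src C t"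
    "Src C p = Tgt C i" "Tgt C p = Tgt C t" "i \<cdot> p = t"
    by (rule factorE[OF t(1)])
  obtain h0 v0 where pb: "weak_pullback C f1 p h0 v0" "v0 \<in> TDen C"
    by (rule pullbackE[of p f1]) (use t f1 ip in simp_all)
  obtain g0 k where po: "weak_pushout C i g g0 k" "k \<in> SDen C"
    by (rule pushoutE[of i g]) (use t g ip in simp_all)
  note D = weak_pullbackD[OF pb(1)] weak_pushoutD[OF po(1)]
  have "fraction_equal C (v \<cdot> b, h \<cdot> g, a \<cdot> w) (v0 \<cdot> b, h0 \<cdot> g0, a \<cdot> (w \<cdot> k))"
    if vh: "composition_data C f1 d f2 s t v h g w" for v h
  proof -
    note F = vh[unfolded composition_data_def]
    \<comment> \<open>It exists because
      \<open>h \<cdot> i \<cdot> p = h \<cdot> t = v \<cdot> f1\<close>.\<close>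
    obtain u where u: "u \<in> Mor C" "Tgt C u = Src C h0" "Src C u = Src C v" "u \<cdot> h0 = h \<cdot> i" "u \<cdot> v0 = v"
      by (rule weak_pullback_induced[OF pb(1), of "h \<cdot> i" v]) (use F ip in simp_all)
    have "u \<in> Den C"
      using Den_cancel(2)[of u v0] u D pb F by simp
    moreover have "h \<cdot> (g \<cdot> k) = u \<cdot> (h0 \<cdot> g0)" "u \<cdot> (v0 \<cdot> b) = v \<cdot> b"
      using comp_reassoc[OF u(4), of g0] comp_reassoc[OF u(5), of b] u D F ip pb po ba by simp_all
    ultimately have "ladder C (v \<cdot> b, h \<cdot> g, a \<cdot> w) (u, k) (v0 \<cdot> b, h0 \<cdot> g0, a \<cdot> (w \<cdot> k))"
      using u D F ip pb po ba by (simp add: ladder_iff)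
    then show ?thesis by (rule ladder_imp_fraction_equal)
  qed
  from this[OF assms(1)] this[OF assms(2)] show ?thesis
    by (blast intro: fraction_equal.sym fraction_equal.trans)
qed

lemma composition_data_right_unique:
  assumes "composition_data C f1 d f2 s t v h g w" "composition_data C f1 d f2 s t v h g' w'"
    and ba: "b \<in> Den C" "Src C b = Src C f1" "a \<in> Den C" "Tgt C a = Tgt C f2"
  shows "fraction_equal C (v \<cdot> b, h \<cdot> g, a \<cdot> w) (v \<cdot> b, h \<cdot> g', a \<cdot> w')"
proof -
  interpret D: uni_fractionable_category "dual C" by (rule uni_fractionable_dual)
  have "fraction_equal (dual C) (a \<cdot> w, h \<cdot> g, v \<cdot> b) (a \<cdot> w', h \<cdot> g', v \<cdot> b)"
    using D.composition_data_left_unique[OF assms(1,2)[THEN composition_data_dual], of a b] ba by simp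
  from fraction_equal_dual[OF this] show ?thesis by simp
qed

lemma composition_data_unique_fixed:
  assumes "composition_data C f1 d f2 s t v h g w" "composition_data C f1 d f2 s t v' h' g' w'"
    and ba: "b \<in> Den C" "Src C b = Src C f1" "a \<in> Den C" "Tgt C a = Tgt C f2"
  shows "fraction_equal C (v \<cdot> b, h \<cdot> g, a \<cdot> w) (v' \<cdot> b, h' \<cdot> g', a \<cdot> w')"
proof -
  \<comment> \<open>For fixed \<open>s\<close> and \<open>t\<close> the conditions on
    \<open>v\<close>, \<open>h\<close> and those on \<open>g\<close>, \<open>w\<close> are
    independent, so halves of two choices can be combined.\<close>
  have "composition_data C f1 d f2 s t v' h' g w"
    using assms(1,2) by (auto simp: composition_data_def)
  then show ?thesis
    using composition_data_left_unique[OF assms(1) _ ba] composition_data_right_unique[OF _ assms(2) ba]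
      fraction_equal.trans by blast
qed

text \<open>Write \<open>s = i \<cdot> p\<close> and keep only \<open>i\<close>: the T-part
  \<open>p\<close> is absorbed into \<open>t\<close> and \<open>g\<close>, and \<open>h\<close> is
  lifted through \<open>p\<close> by a weak pullback. The resulting 3-arrow differs by the ladder
  with columns \<open>v0\<close> and an identity.\<close>

lemma composition_data_SDen:
  assumes "composition_data C f1 d f2 s t v h g w"
    and ba: "b \<in> Den C" "Src C b = Src C f1" "a \<in> Den C" "Tgt C a = Tgt C f2"
  obtains s' t' v' h' g' w' where "s' \<in> SDen C" "composition_data C f1 d f2 s' t' v' h' g' w'"
    "fraction_equal C (v' \<cdot> b, h' \<cdot> g', a \<cdot> w') (v \<cdot> b, h \<cdot> g, a \<cdot> w)"
proof -
  note F = assms(1)[unfolded composition_data_def]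
  have "s \<in> Den C" using F by simp
  then obtain i p where ip: "i \<in> SDen C" "p \<in> TDen C" "Src C i = Src C s"
    "Src C p = Tgt C i" "Tgt C p = Tgt C s" "i \<cdot> p = s"
    by (rule factorE)
  obtain h0 v0 where pb: "weak_pullback C h p h0 v0" "v0 \<in> TDen C"
    by (rule pullbackE[of p h]) (use F ip in simp_all)
  note D = weak_pullbackD[OF pb(1)]
  have 1: "i \<cdot> (p \<cdot> t) = d" "i \<cdot> (p \<cdot> g) = f2 \<cdot> w"
    using comp_reassoc[OF ip(6), of t] comp_reassoc[OF ip(6), of g] ip F by simp_all
  have 2: "h0 \<cdot> (p \<cdot> t) = v0 \<cdot> (v \<cdot> f1)" "h0 \<cdot> (p \<cdot> g) = v0 \<cdot> (h \<cdot> g)"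
    using comp_reassoc[OF D(9), of t] comp_reassoc[OF D(9), of g] D ip F by simp_all
  have "composition_data C f1 d f2 i (p \<cdot> t) (v0 \<cdot> v) h0 (p \<cdot> g) w"
    unfolding composition_data_def using F ip D pb 1 2 by simp
  moreover have "ladder C (v0 \<cdot> (v \<cdot> b), v0 \<cdot> (h \<cdot> g), a \<cdot> w) (v0, Idt C (Tgt C g)) (v \<cdot> b, h \<cdot> g, a \<cdot> w)"
    using Tgt_in_Obj[of g] F ip D pb ba by (simp add: ladder_iff)
  then have "fraction_equal C ((v0 \<cdot> v) \<cdot> b, h0 \<cdot> (p \<cdot> g), a \<cdot> w) (v \<cdot> b, h \<cdot> g, a \<cdot> w)"
    using F D pb ba 2 ladder_imp_fraction_equal by simp
  ultimately show ?thesis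
    using that ip(1) by blast
qed

text \<open>Two factorisations of \<open>d\<close> that begin with S-denominators are compared with the one through
  the weak pushout of these.\<close>

lemma composition_data_SDen_unique:
  assumes F: "composition_data C f1 d f2 j q v h g w" "j \<in> SDen C"
    and F': "composition_data C f1 d f2 j' q' v' h' g' w'" "j' \<in> SDen C"
    and ba: "b \<in> Den C" "Src C b = Src C f1" "a \<in> Den C" "Tgt C a = Tgt C f2"
  shows "fraction_equal C (v \<cdot> b, h \<cdot> g, a \<cdot> w) (v' \<cdot> b, h' \<cdot> g', a \<cdot> w')"
proof -
  note E = F(1)[unfolded composition_data_def] and E' = F'(1)[unfolded composition_data_def]
  obtain u u' where po: "weak_pushout C j j' u u'" "u' \<in> SDen C"
    by (rule pushoutE[of j j']) (use F(2) E E' in simp_all)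
  note D = weak_pushoutD[OF po(1)]
  obtain x where x: "x \<in> Mor C" "Src C x = Tgt C u" "Tgt C x = Tgt C q'" "u \<cdot> x = q" "u' \<cdot> x = q'"
    by (rule weak_pushout_induced[OF po(1), of q q']) (use E E' in simp_all)
  \<comment> \<open>\<open>j \<cdot> u = j' \<cdot> u'\<close> with \<open>x\<close> as second
    factor is the common factorisation of \<open>d\<close>.\<close>
  have "j \<cdot> u \<in> SDen C"
    using comp_denominators(2)[of j' u'] F'(2) po D by simp
  then obtain g0 w0 where po0: "weak_pushout C (j \<cdot> u) f2 g0 w0" "w0 \<in> SDen C"
    by (rule pushoutE) (use E E' D in simp_all)
  note D0 = weak_pushoutD[OF po0(1)]
  have Den: "u \<in> Den C" "x \<in> Den C"
    using Den_cancel(1)[of j u] Den_cancel(1)[of u' x] \<open>j \<cdot> u \<in> SDen C\<close> x D E E' po by simp_all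
  have ju: "j \<cdot> (u \<cdot> g0) = f2 \<cdot> w0" "j' \<cdot> (u' \<cdot> g0) = f2 \<cdot> w0"
    using D0 comp_reassoc[OF D(9), of g0] D E E' by simp_all
  have types: "Src C g0 = Tgt C u" "g0 \<in> Mor C" "w0 \<in> Den C" "Src C w0 = Tgt C f2" "Tgt C w0 = Tgt C g0"
    "u' \<in> Den C" "Tgt C u' = Tgt C u" "Src C u = Tgt C j" "Src C u' = Tgt C j'" "Tgt C q' = Tgt C f1"
    using D0 D po0(2) po(2) E E' by simp_all
  \<comment> \<open>Facts 1 and 4 keep the given factorisations, 2 and 3 use the common one. By
    associativity 1 and 2 yield the same 3-arrow, and so do 4 and 3; thus only data with equal
    factorisations remain to be compared.\<close>
  have 1: "composition_data C f1 d f2 j q v h (u \<cdot> g0) w0"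
    unfolding composition_data_def using E types Den ju by simp
  have 4: "composition_data C f1 d f2 j' q' v' h' (u' \<cdot> g0) w0"
    unfolding composition_data_def using E' types Den ju by simp
  have 2: "composition_data C f1 d f2 (j \<cdot> u) x v (h \<cdot> u) g0 w0"
    unfolding composition_data_def using E types x Den ju by simp
  have 3: "composition_data C f1 d f2 (j' \<cdot> u') x v' (h' \<cdot> u') g0 w0"
    unfolding composition_data_def using E' types x Den ju by simp
  have "fraction_equal C (v \<cdot> b, h \<cdot> (u \<cdot> g0), a \<cdot> w0) (v' \<cdot> b, h' \<cdot> (u' \<cdot> g0), a \<cdot> w0)"
    using composition_data_unique_fixed[OF 2 3[folded D(9)] ba] E E' types Den by simp
  with composition_data_unique_fixed[OF F(1) 1 ba] composition_data_unique_fixed[OF 4 F'(1) ba] show ?thesis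
    by (blast intro: fraction_equal.trans)
qed

lemma composition_data_unique:
  assumes "composition_data C f1 d f2 s t v h g w" "composition_data C f1 d f2 s' t' v' h' g' w'"
    and ba: "b \<in> Den C" "Src C b = Src C f1" "a \<in> Den C" "Tgt C a = Tgt C f2"
  shows "fraction_equal C (v \<cdot> b, h \<cdot> g, a \<cdot> w) (v' \<cdot> b, h' \<cdot> g', a \<cdot> w')"
  by (rule composition_data_SDen[OF assms(1) ba], rule composition_data_SDen[OF assms(2) ba])
    (meson composition_data_SDen_unique[OF _ _ _ _ ba] fraction_equal.sym fraction_equal.trans)

lemma composite_unique:
  assumes "A \<in> three_arrows C X Y" "B \<in> three_arrows C Y Z" "composite C A B D" "composite C A B D'"
  shows "fraction_equal C D D'"
  using assms by (cases A; cases B) (auto simp: composite_def three_arrows_iff intro: composition_data_unique)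

lemma composite_exists:
  assumes "A \<in> three_arrows C X Y" "B \<in> three_arrows C Y Z"
  obtains D where "composite C A B D"
proof -
  obtain b1 f1 a1 b2 f2 a2 where [simp]: "A = (b1, f1, a1)" "B = (b2, f2, a2)"
    by (metis prod_cases3)
  obtain s t v h g w where "composition_data C f1 (b2 \<cdot> a1) f2 s t v h g w"
    by (rule composition_data_exists[of "b2 \<cdot> a1" f1 f2]) (use assms in \<open>simp_all add: three_arrows_iff\<close>)
  then have "composite C A B (v \<cdot> b1, h \<cdot> g, a2 \<cdot> w)"
    by (simp add: compositeI)
  then show ?thesis by (rule that)
qed

section \<open>Independence of composites from the representatives\<close>

lemma composite_three_arrows:
  assumes "A \<in> three_arrows C X Y" "B \<in> three_arrows C Y Z" "composite C A B D"
  shows "D \<in> three_arrows C X Z"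
  using assms by (cases A; cases B) (auto simp: composite_def three_arrows_iff composition_data_def)

text \<open>The columns are absorbed into the factors: \<open>t\<close> becomes
  \<open>t \<cdot> e\<close> and \<open>v\<close> becomes \<open>v \<cdot> c\<close>, while
  \<open>D\<close> is unchanged. Arbitrary denominators matter here, as \<open>t \<cdot> e\<close>
  need not be a T-denominator.\<close>

lemma composite_ladder_left:
  assumes "ladder C A (c, e) A'" "A \<in> three_arrows C X Y" "B \<in> three_arrows C Y Z" "composite C A B D"
  shows "composite C A' B D"
proof -
  obtain b f a b' f' a' b2 f2 a2 where [simp]: "A = (b, f, a)" "A' = (b', f', a')" "B = (b2, f2, a2)"
    by (metis prod_cases3)
  note facts = assms(1-3)[simplified ladder_iff three_arrows_iff this]
  obtain s t v h g w where data: "composition_data C f (b2 \<cdot> a) f2 s t v h g w"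
    and D: "D = (v \<cdot> b, h \<cdot> g, a2 \<cdot> w)"
    using assms(4) by (auto simp: composite_def)
  note F = data[unfolded composition_data_def]
  have 1: "h \<cdot> (t \<cdot> e) = v \<cdot> (c \<cdot> f')"
    using comp_reassoc[of h t "v \<cdot> f" e] facts F by simp
  have 2: "s \<cdot> (t \<cdot> e) = b2 \<cdot> a'"
    using comp_reassoc[of s t "b2 \<cdot> a" e] facts F by simp
  have "composition_data C f' (b2 \<cdot> a') f2 s (t \<cdot> e) (v \<cdot> c) h g w"
    unfolding composition_data_def using facts F 1 2 by simp
  from compositeI[OF this, of b' a2]
  have "composite C A' B ((v \<cdot> c) \<cdot> b', h \<cdot> g, a2 \<cdot> w)" by simp
  moreover have "D = ((v \<cdot> c) \<cdot> b', h \<cdot> g, a2 \<cdot> w)"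
    using facts F D by simp
  ultimately show ?thesis by (simp only:)
qed

lemma ladder_three_arrows:
  assumes "ladder C A (c, e) B"
  shows "A \<in> three_arrows C X Y \<longleftrightarrow> B \<in> three_arrows C X Y"
  using fraction_equal_three_arrows[OF ladder_imp_fraction_equal[OF assms]] .

lemma composite_cong_left:
  assumes "fraction_equal C A A'" "A \<in> three_arrows C X Y" "B \<in> three_arrows C Y Z" "composite C A B D"
    "composite C A' B D'"
  shows "fraction_equal C D D'"
proof -
  have "A' \<in> three_arrows C X Y \<and> (\<forall>D'. composite C A' B D' \<longrightarrow> fraction_equal C D D')"
    using assms(1)
  proof (induction rule: fraction_equal_induct)
    case refl
    show ?case using composite_unique assms(2-4) by blast
  next
    case (forward A' c e A'')
    then have A': "A' \<in> three_arrows C X Y" "A'' \<in> three_arrows C X Y"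
      using ladder_three_arrows by blast+
    \<comment> \<open>A ladder transports composites only from its source to its target, so a
      composite \<open>E\<close> of \<open>A'\<close> mediates between the induction hypothesis and
      the composites of \<open>A''\<close>.\<close>
    obtain E where "composite C A' B E"
      using composite_exists A'(1) assms(3) by blast
    moreover have "composite C A'' B E"
      using composite_ladder_left[OF forward(2) A'(1) assms(3)] calculation .
    ultimately show ?case
      using forward(1) A'(2) composite_unique[OF A'(2) assms(3)] fraction_equal.trans by blast
  next
    case (backward A' c e A'')
    then have "A'' \<in> three_arrows C X Y"
      using ladder_three_arrows by blast
    with backward show ?case
      using composite_ladder_left assms(3) by blast
  qed
  with assms(5) show ?thesis by blast
qed

lemma composite_cong_right:
  assumes "fraction_equal C B B'" "A \<in> three_arrows C X Y" "B \<in> three_arrows C Y Z" "composite C A B D"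
    "composite C A B' D'"
  shows "fraction_equal C D D'"
proof -
  interpret D: uni_fractionable_category "dual C" by (rule uni_fractionable_dual)
  have "fraction_equal (dual C) (dual_three_arrow D) (dual_three_arrow D')"
    using D.composite_cong_left[OF fraction_equal_dual[OF assms(1)] three_arrows_dual[OF assms(3)]
        three_arrows_dual[OF assms(2)] composite_dual[OF assms(4)] composite_dual[OF assms(5)]] .
  from fraction_equal_dual[OF this] show ?thesis by simp
qed

lemma composite_cong:
  assumes "fraction_equal C A A'" "fraction_equal C B B'"
    "A \<in> three_arrows C X Y" "B \<in> three_arrows C Y Z" "composite C A B D" "composite C A' B' D'"
  shows "fraction_equal C D D'"
proof -
  have A': "A' \<in> three_arrows C X Y"
    using fraction_equal_three_arrows assms by blast
  then obtain E where "composite C A' B E"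
    using composite_exists assms(4) by blast
  with assms A' show ?thesis
    using composite_cong_left composite_cong_right fraction_equal.trans by blast
qed

text \<open>Resolves the definite description in \<open>Frac_comp\<close>. The prescribed factors
  exist, and any admissible ones are composition data, hence lead to the class of \<open>D\<close>
  by \<open>composite_cong\<close>. The composite \<open>D\<close> itself may use arbitrary
  denominators.\<close>

lemma Frac_comp_double_fraction:
  assumes A: "A \<in> three_arrows C X Y" and B: "B \<in> three_arrows C Y Z" and D: "composite C A B D"
  shows "double_fraction C A \<cdot>\<^bsub>Frac C\<^esub> double_fraction C B = double_fraction C D"
proof -
  obtain b1 f1 a1 b2 f2 a2 where [simp]: "A = (b1, f1, a1)" "B = (b2, f2, a2)"
    by (metis prod_cases3)
  \<comment> \<open>The predicate under \<open>THE\<close> in \<open>Frac_comp_def\<close>, at the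
    two given classes.\<close>
  let ?P = "\<lambda>H. \<exists>X Y Z b1 f1 a1 b2 f2 a2 j q q' f1' j' f2'.
        (b1, f1, a1) \<in> three_arrows C X Y \<and> double_fraction C A = double_fraction C (b1, f1, a1) \<and>
        (b2, f2, a2) \<in> three_arrows C Y Z \<and> double_fraction C B = double_fraction C (b2, f2, a2) \<and>
        j \<in> SDen C \<and> q \<in> TDen C \<and> Tgt C j = Src C q \<and> b2 \<cdot> a1 = j \<cdot> q \<and>
        q' \<in> TDen C \<and> Tgt C q' = Src C f1 \<and> f1' \<in> hom C (Src C q') (Src C q) \<and>
        f1' \<cdot> q = q' \<cdot> f1 \<and>
        j' \<in> SDen C \<and> Src C j' = Tgt C f2 \<and> f2' \<in> hom C (Tgt C j) (Tgt C j') \<and>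
        j \<cdot> f2' = f2 \<cdot> j' \<and>
        H = double_fraction C (q' \<cdot> b1, f1' \<cdot> f2', a2 \<cdot> j')"
  obtain s t v h g w where data: "composition_data C f1 (b2 \<cdot> a1) f2 s t v h g w"
    and mem: "s \<in> SDen C" "t \<in> TDen C" "v \<in> TDen C" "w \<in> SDen C"
    by (rule composition_data_exists[of "b2 \<cdot> a1" f1 f2]) (use A B in \<open>simp_all add: three_arrows_iff\<close>)
  note F = data[unfolded composition_data_def]
  have "composite C A B (v \<cdot> b1, h \<cdot> g, a2 \<cdot> w)"
    using compositeI[OF data] by simp
  then have "double_fraction C (v \<cdot> b1, h \<cdot> g, a2 \<cdot> w) = double_fraction C D"
    using composite_unique[OF A B _ D] composite_three_arrows[OF A B] double_fraction_eq_iff by blast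
  note this[symmetric]
  moreover have "Tgt C s = Src C t" "b2 \<cdot> a1 = s \<cdot> t" "Tgt C v = Src C f1"
    "h \<in> hom C (Src C v) (Src C t)" "h \<cdot> t = v \<cdot> f1"
    "Src C w = Tgt C f2" "g \<in> hom C (Tgt C s) (Tgt C w)" "s \<cdot> g = f2 \<cdot> w"
    using F by (simp_all add: hom_iff)
  moreover have "(b1, f1, a1) \<in> three_arrows C X Y" "double_fraction C A = double_fraction C (b1, f1, a1)"
    "(b2, f2, a2) \<in> three_arrows C Y Z" "double_fraction C B = double_fraction C (b2, f2, a2)"
    using A B by simp_all
  ultimately have ex: "?P (double_fraction C D)"
    using mem by blast
  have "H = double_fraction C D" if H: "?P H" for H
  proof -
    from H obtain X' Y' Z' c1 g1 e1 c2 g2 e2 j q q' f1' j' f2' where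
      A': "(c1, g1, e1) \<in> three_arrows C X' Y'" "double_fraction C A = double_fraction C (c1, g1, e1)"
      and B': "(c2, g2, e2) \<in> three_arrows C Y' Z'" "double_fraction C B = double_fraction C (c2, g2, e2)"
      and jq: "j \<in> SDen C" "q \<in> TDen C" "Tgt C j = Src C q" "c2 \<cdot> e1 = j \<cdot> q"
        "q' \<in> TDen C" "Tgt C q' = Src C g1" "f1' \<in> hom C (Src C q') (Src C q)" "f1' \<cdot> q = q' \<cdot> g1"
        "j' \<in> SDen C" "Src C j' = Tgt C g2" "f2' \<in> hom C (Tgt C j) (Tgt C j')" "j \<cdot> f2' = g2 \<cdot> j'"
      and Heq: "H = double_fraction C (q' \<cdot> c1, f1' \<cdot> f2', e2 \<cdot> j')"
      by blast
    have "Src C (c2 \<cdot> e1) = Src C g2" "Tgt C (c2 \<cdot> e1) = Tgt C g1"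
      using A'(1) B'(1) by (simp_all add: three_arrows_iff)
    then have "Src C j = Src C g2" "Tgt C q = Tgt C g1"
      using jq by simp_all
    then have "composition_data C g1 (c2 \<cdot> e1) g2 j q q' f1' f2' j'"
      unfolding composition_data_def using A'(1) B'(1) jq by (simp add: hom_iff three_arrows_iff)
    then have "composite C (c1, g1, e1) (c2, g2, e2) (q' \<cdot> c1, f1' \<cdot> f2', e2 \<cdot> j')"
      by (rule compositeI)
    moreover have "fraction_equal C A (c1, g1, e1)" "fraction_equal C B (c2, g2, e2)"
      using A'(2) B'(2) A B double_fraction_eq_iff by blast+
    ultimately have "fraction_equal C D (q' \<cdot> c1, f1' \<cdot> f2', e2 \<cdot> j')"
      using composite_cong A B D by blast
    then show ?thesis
      using composite_three_arrows[OF A B D] double_fraction_eq_iff Heq by blast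
  qed
  with ex have "Frac_comp C (double_fraction C A) (double_fraction C B) = double_fraction C D"
    unfolding Frac_comp_def by (rule the_equality)
  then show ?thesis by (simp add: Frac_def)
qed

end

section \<open>Diagrams for equalities of double fractions\<close>

context uni_fractionable_category
begin

text \<open>Each line of three equations is one ladder of the reduced zigzag. Normality of the
  middle columns comes down to the \<open>p\<close>s being T- and the \<open>i\<close>s being
  S-denominators.\<close>

lemma zigzag_diagram:
  assumes "(b1, f1, a1) \<in> three_arrows C X Y" "(b2, f2, a2) \<in> three_arrows C X Y"
  shows "(tb1, tf1, ta1) \<in> three_arrows C X Y \<and> (tb2, tf2, ta2) \<in> three_arrows C X Y \<and>
      (p1, d1, i1) \<in> normal_three_arrows C (Src C f1) (Src C f2) \<and>
      (p2, d2, i2) \<in> normal_three_arrows C (Tgt C f1) (Tgt C f2) \<and>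
      d1 \<in> Den C \<and> d1 \<in> hom C (Src C tf1) (Src C tf2) \<and>
      d2 \<in> Den C \<and> d2 \<in> hom C (Tgt C tf1) (Tgt C tf2) \<and>
      tb1 = p1 \<cdot> b1 \<and> tf1 \<cdot> p2 = p1 \<cdot> f1 \<and> ta1 \<cdot> p2 = a1 \<and>
      tb1 = d1 \<cdot> tb2 \<and> tf1 \<cdot> d2 = d1 \<cdot> tf2 \<and> ta1 \<cdot> d2 = ta2 \<and>
      b2 = i1 \<cdot> tb2 \<and> f2 \<cdot> i2 = i1 \<cdot> tf2 \<and> a2 \<cdot> i2 = ta2 \<longleftrightarrow>
    p1 \<in> TDen C \<and> p2 \<in> TDen C \<and> i1 \<in> SDen C \<and> i2 \<in> SDen C \<and>
      ladder C (tb1, tf1, ta1) (p1, p2) (b1, f1, a1) \<and>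
      ladder C (tb1, tf1, ta1) (d1, d2) (tb2, tf2, ta2) \<and>
      ladder C (b2, f2, a2) (i1, i2) (tb2, tf2, ta2)" (is "?L \<longleftrightarrow> ?R")
proof
  assume ?L
  with assms show ?R
    unfolding three_arrows_iff normal_three_arrows_iff hom_iff ladder_iff by argo
next
  assume ?R
  moreover from this have "d1 \<in> Mor C" "d2 \<in> Mor C" by (simp_all add: ladder_iff)
  ultimately show ?L using assms
    unfolding three_arrows_iff normal_three_arrows_iff hom_iff ladder_iff by argo
qed

lemma zigzag_imp_fraction_equal:
  assumes "ladder C D d A" "ladder C D d' E" "ladder C B d'' E"
  shows "fraction_equal C A B"
  using assms ladder_imp_fraction_equal fraction_equal.sym fraction_equal.trans by (metis surj_pair)

lemma ladder_composable:
  assumes "ladder C A (c, e) B" "ladder C B (c', e') D"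
  shows "Tgt C c = Src C c'" "Tgt C e = Src C e'"
  using assms by (cases A; cases B; cases D; simp add: ladder_iff)+

text \<open>A T-ladder into \<open>D\<close> and an S-ladder out of \<open>E\<close> normalise the
  two middle rows. The outer ladders stay of their kind because T- and S-denominators are closed
  under composition.\<close>

lemma fraction_equal_imp_normal_zigzag:
  assumes eq: "fraction_equal C A B"
    and A: "A \<in> normal_three_arrows C X Y" and B: "B \<in> normal_three_arrows C X Y"
  shows "\<exists>D E p p' d d' i i'. D \<in> normal_three_arrows C X Y \<and> E \<in> normal_three_arrows C X Y \<and>
    p \<in> TDen C \<and> p' \<in> TDen C \<and> i \<in> SDen C \<and> i' \<in> SDen C \<and>
    ladder C D (p, p') A \<and> ladder C D (d, d') E \<and> ladder C B (i, i') E"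
proof -
  have XY: "Tgt C (fst A) = X" "Src C (snd (snd A)) = Y" "fst A \<in> TDen C"
    "Tgt C (fst B) = X" "Src C (snd (snd B)) = Y" "snd (snd B) \<in> SDen C"
    using A B by (cases A; cases B; simp add: normal_three_arrows_iff three_arrows_iff)+
  obtain D E p p' d d' i i' where p: "p \<in> TDen C" "p' \<in> TDen C" "ladder C D (p, p') A"
    and d: "ladder C D (d, d') E" and i: "i \<in> SDen C" "i' \<in> SDen C" "ladder C B (i, i') E"
    using fraction_equal_imp_zigzag[OF eq] by blast
  obtain D' q q' where q: "q \<in> TDen C" "q' \<in> TDen C" "ladder C D' (q, q') D"
    and D': "D' \<in> normal_three_arrows C X Y"
    using normalise_source[OF p(3,1,2) XY(3)] unfolding XY by blast
  obtain E' j j' where j: "j \<in> SDen C" "j' \<in> SDen C" "ladder C E (j, j') E'"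
    and E': "E' \<in> normal_three_arrows C X Y"
    using normalise_target[OF i(3,1,2) XY(6)] unfolding XY by blast
  have "q \<cdot> p \<in> TDen C" "q' \<cdot> p' \<in> TDen C" "i \<cdot> j \<in> SDen C" "i' \<cdot> j' \<in> SDen C"
    using p q i j ladder_composable[OF q(3) p(3)] ladder_composable[OF i(3) j(3)] by simp_all
  with D' E' ladder_comp[OF q(3) p(3)] ladder_comp[OF i(3) j(3)] ladder_comp[OF ladder_comp[OF q(3) d] j(3)]
  show ?thesis by blast
qed

lemma double_fraction_eq_iff_diagram:
  assumes A: "(b1, f1, a1) \<in> three_arrows C X Y" and B: "(b2, f2, a2) \<in> three_arrows C X Y"
  shows "double_fraction C (b1, f1, a1) = double_fraction C (b2, f2, a2) \<longleftrightarrow>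
    (\<exists>tb1 tf1 ta1 tb2 tf2 ta2 p1 d1 i1 p2 d2 i2.
       (tb1, tf1, ta1) \<in> three_arrows C X Y \<and> (tb2, tf2, ta2) \<in> three_arrows C X Y \<and>
       (p1, d1, i1) \<in> normal_three_arrows C (Src C f1) (Src C f2) \<and>
       (p2, d2, i2) \<in> normal_three_arrows C (Tgt C f1) (Tgt C f2) \<and>
       d1 \<in> Den C \<and> d1 \<in> hom C (Src C tf1) (Src C tf2) \<and>
       d2 \<in> Den C \<and> d2 \<in> hom C (Tgt C tf1) (Tgt C tf2) \<and>
       tb1 = p1 \<cdot> b1 \<and> tf1 \<cdot> p2 = p1 \<cdot> f1 \<and> ta1 \<cdot> p2 = a1 \<and>
       tb1 = d1 \<cdot> tb2 \<and> tf1 \<cdot> d2 = d1 \<cdot> tf2 \<and> ta1 \<cdot> d2 = ta2 \<and>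
       b2 = i1 \<cdot> tb2 \<and> f2 \<cdot> i2 = i1 \<cdot> tf2 \<and> a2 \<cdot> i2 = ta2)"
  unfolding zigzag_diagram[OF A B] double_fraction_eq_iff[OF A]
proof
  assume "fraction_equal C (b1, f1, a1) (b2, f2, a2)"
  from fraction_equal_imp_zigzag[OF this]
  show "\<exists>tb1 tf1 ta1 tb2 tf2 ta2 p1 d1 i1 p2 d2 i2.
    p1 \<in> TDen C \<and> p2 \<in> TDen C \<and> i1 \<in> SDen C \<and> i2 \<in> SDen C \<and>
      ladder C (tb1, tf1, ta1) (p1, p2) (b1, f1, a1) \<and>
      ladder C (tb1, tf1, ta1) (d1, d2) (tb2, tf2, ta2) \<and>
      ladder C (b2, f2, a2) (i1, i2) (tb2, tf2, ta2)"
    unfolding split_paired_Ex by blast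
qed (use zigzag_imp_fraction_equal in blast)

lemma double_fraction_eq_iff_normal_diagram:
  assumes A: "(b1, f1, a1) \<in> normal_three_arrows C X Y" and B: "(b2, f2, a2) \<in> normal_three_arrows C X Y"
  shows "double_fraction C (b1, f1, a1) = double_fraction C (b2, f2, a2) \<longleftrightarrow>
    (\<exists>tb1 tf1 ta1 tb2 tf2 ta2 p1 d1 i1 p2 d2 i2.
       (tb1, tf1, ta1) \<in> normal_three_arrows C X Y \<and> (tb2, tf2, ta2) \<in> normal_three_arrows C X Y \<and>
       (p1, d1, i1) \<in> normal_three_arrows C (Src C f1) (Src C f2) \<and>
       (p2, d2, i2) \<in> normal_three_arrows C (Tgt C f1) (Tgt C f2) \<and>
       d1 \<in> Den C \<and> d1 \<in> hom C (Src C tf1) (Src C tf2) \<and>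
       d2 \<in> Den C \<and> d2 \<in> hom C (Tgt C tf1) (Tgt C tf2) \<and>
       tb1 = p1 \<cdot> b1 \<and> tf1 \<cdot> p2 = p1 \<cdot> f1 \<and> ta1 \<cdot> p2 = a1 \<and>
       tb1 = d1 \<cdot> tb2 \<and> tf1 \<cdot> d2 = d1 \<cdot> tf2 \<and> ta1 \<cdot> d2 = ta2 \<and>
       b2 = i1 \<cdot> tb2 \<and> f2 \<cdot> i2 = i1 \<cdot> tf2 \<and> a2 \<cdot> i2 = ta2)" (is "?L \<longleftrightarrow> ?R")
proof
  have A': "(b1, f1, a1) \<in> three_arrows C X Y" and B': "(b2, f2, a2) \<in> three_arrows C X Y"
    using A B by (simp_all add: normal_three_arrows_iff)
  show ?R if ?L
  proof -
    from that have "fraction_equal C (b1, f1, a1) (b2, f2, a2)"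
      using double_fraction_eq_iff[OF A'] by blast
    from fraction_equal_imp_normal_zigzag[OF this A B]
    obtain tb1 tf1 ta1 tb2 tf2 ta2 p1 d1 i1 p2 d2 i2 where
      N: "(tb1, tf1, ta1) \<in> normal_three_arrows C X Y" "(tb2, tf2, ta2) \<in> normal_three_arrows C X Y"
      and "p1 \<in> TDen C \<and> p2 \<in> TDen C \<and> i1 \<in> SDen C \<and> i2 \<in> SDen C \<and>
        ladder C (tb1, tf1, ta1) (p1, p2) (b1, f1, a1) \<and>
        ladder C (tb1, tf1, ta1) (d1, d2) (tb2, tf2, ta2) \<and>
        ladder C (b2, f2, a2) (i1, i2) (tb2, tf2, ta2)"
      unfolding split_paired_Ex by blast
    from this(3)[folded zigzag_diagram[OF A' B']] N show ?R by blast
  qed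
  show ?L if ?R
    using that unfolding double_fraction_eq_iff_diagram[OF A' B'] normal_three_arrows_iff[of _ _ _ X Y]
    by blast
qed

section \<open>The diagrams of part (b)\<close>

lemma square_imp_Frac_eq:
  assumes A: "(b1, f1, a1) \<in> three_arrows C X Y" "(p2, g2, i2) \<in> three_arrows C Y Z"
    and B: "(p1, g1, i1) \<in> three_arrows C X' Y'" "(b2, f2, a2) \<in> three_arrows C Y' Z'"
    and T: "(tb1, tf1, ta1) \<in> three_arrows C (Src C g1) (Src C g2)"
      "(tb2, tf2, ta2) \<in> three_arrows C (Tgt C g1) (Tgt C g2)"
      "(tp1, tg1, ti1) \<in> normal_three_arrows C (Src C f1) (Src C f2)"
      "(tp2, tg2, ti2) \<in> normal_three_arrows C (Tgt C f1) (Tgt C f2)"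
      "tg1 \<in> hom C (Src C tf1) (Src C tf2)" "tg2 \<in> hom C (Tgt C tf1) (Tgt C tf2)"
    and eqs: "tb1 \<cdot> p1 = tp1 \<cdot> b1" "tf1 \<cdot> tp2 = tp1 \<cdot> f1" "ta1 \<cdot> tp2 = p2 \<cdot> a1"
      "tb1 \<cdot> g1 = tg1 \<cdot> tb2" "tf1 \<cdot> tg2 = tg1 \<cdot> tf2" "ta1 \<cdot> tg2 = g2 \<cdot> ta2"
      "b2 \<cdot> i1 = ti1 \<cdot> tb2" "f2 \<cdot> ti2 = ti1 \<cdot> tf2" "a2 \<cdot> ti2 = i2 \<cdot> ta2"
  shows "double_fraction C (b1, f1, a1) \<cdot>\<^bsub>Frac C\<^esub> double_fraction C (p2, g2, i2)
    = double_fraction C (p1, g1, i1) \<cdot>\<^bsub>Frac C\<^esub> double_fraction C (b2, f2, a2)"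
proof -
  note F = assms(1-8)[unfolded normal_three_arrows_iff three_arrows_iff] T(5,6)[unfolded hom_iff]
  have "composition_data C f1 (p2 \<cdot> a1) g2 ta1 tp2 tp1 tf1 tg2 ta2"
    unfolding composition_data_def using F eqs(2,3,6) by simp
  from Frac_comp_double_fraction[OF A compositeI[OF this]]
  have "double_fraction C (b1, f1, a1) \<cdot>\<^bsub>Frac C\<^esub> double_fraction C (p2, g2, i2)
    = double_fraction C (tp1 \<cdot> b1, tf1 \<cdot> tg2, i2 \<cdot> ta2)" .
  moreover have "composition_data C g1 (b2 \<cdot> i1) f2 ti1 tb2 tb1 tg1 tf2 ti2"
    unfolding composition_data_def using F eqs(4,7,8) by simp
  from Frac_comp_double_fraction[OF B compositeI[OF this]]
  have "double_fraction C (p1, g1, i1) \<cdot>\<^bsub>Frac C\<^esub> double_fraction C (b2, f2, a2)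
    = double_fraction C (tb1 \<cdot> p1, tg1 \<cdot> tf2, a2 \<cdot> ti2)" .
  ultimately show ?thesis
    using eqs by simp
qed

text \<open>A ladder \<open>l\<close> between the left denominators \<open>r' \<cdot> p\<close> and \<open>x\<close> of two composites is
  converted into the left column of squares of a 3-by-3 diagram.\<close>

lemma transpose_column:
  assumes p: "p \<in> TDen C" "g \<in> Mor C" "Src C g = Src C p"
    and x: "x \<in> Den C" "Tgt C x = Tgt C p"
    and l: "l \<in> Den C" "Src C l = Src C r'" "Tgt C l = Src C x"
    and d: "d \<in> Mor C" "Tgt C d = Src C x"
    and r': "r' \<in> Den C" "Tgt C r' = Src C p" "r' \<cdot> p = l \<cdot> x"
    and m: "m \<in> Mor C" "Src C m = Src C r'" "r \<in> Den C" "Src C r = Tgt C m" "Tgt C r = Tgt C g"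
      "m \<cdot> r = r' \<cdot> g"
  obtains e u j d' u' m' j' y where
    "e \<in> Den C" "Tgt C e = Src C p" "u \<in> TDen C" "Src C u = Src C e" "Tgt C u = Src C x"
    "j \<in> SDen C" "Src C j = Src C r'" "Tgt C j = Src C e"
    "e \<cdot> p = u \<cdot> x" "j \<cdot> e = r'" "j \<cdot> u = l"
    "weak_pullback C d u d' u'" "u' \<in> TDen C"
    "weak_pushout C j m m' j'" "j' \<in> SDen C"
    "y \<in> Den C" "Src C y = Tgt C m'" "Tgt C y = Tgt C g" "m' \<cdot> y = e \<cdot> g" "j' \<cdot> y = r"
proof -
  obtain e0 u0 where pb: "weak_pullback C x p e0 u0" "u0 \<in> TDen C"
    by (rule pullbackE[of p x]) (use p x in simp_all)
  note D0 = weak_pullbackD[OF pb(1)]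
  obtain y0 where y0: "y0 \<in> Mor C" "Tgt C y0 = Src C e0" "Src C y0 = Src C l" "y0 \<cdot> e0 = r'" "y0 \<cdot> u0 = l"
    by (rule weak_pullback_induced[OF pb(1), of r' l]) (use l r' in simp_all)
  have Den: "e0 \<in> Den C" "y0 \<in> Den C"
    using Den_cancel(2)[of e0 p] Den_cancel(2)[of y0 u0] D0 y0 p(1) x(1) l(1) pb(2) by simp_all
  obtain j q where jq: "j \<in> SDen C" "q \<in> TDen C" "Src C j = Src C y0"
    "Src C q = Tgt C j" "Tgt C q = Tgt C y0" "j \<cdot> q = y0"
    by (rule factorE[OF Den(2)])
  \<comment> \<open>The T-part \<open>q\<close> of \<open>y0\<close> is absorbed into both sides of
    the pullback square; \<open>u\<close> remains a T-denominator, and the S-part \<open>j\<close>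
    is left for a weak pushout.\<close>
  define e u where "e = q \<cdot> e0" and "u = q \<cdot> u0"
  have e: "e \<in> Den C" "Src C e = Tgt C j" "Tgt C e = Src C p"
    and u: "u \<in> TDen C" "Src C u = Tgt C j" "Tgt C u = Src C x"
    unfolding e_def u_def using jq(1,2,4,5) y0(1-3) D0(1-8) Den pb(2) by simp_all
  have eqs: "e \<cdot> p = u \<cdot> x" "j \<cdot> e = r'" "j \<cdot> u = l"
    unfolding e_def u_def using D0 p x jq(1,2,4,5) y0 comp_reassoc[OF jq(6), of e0] comp_reassoc[OF jq(6), of u0]
    by simp_all
  obtain d' u' where dpb: "weak_pullback C d u d' u'" "u' \<in> TDen C"
    by (rule pullbackE[of u d]) (use u d in simp_all)
  have j: "Src C j = Src C r'"
    using jq(3) y0(3) l(2) by simp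
  obtain m' j' where po: "weak_pushout C j m m' j'" "j' \<in> SDen C"
    by (rule pushoutE[of j m]) (use jq(1) j m in simp_all)
  note D = weak_pushoutD[OF po(1)]
  \<comment> \<open>The comparison morphism \<open>y\<close> out of the weak pushout serves below as
    the left denominator of the second new row.\<close>
  have "j \<cdot> (e \<cdot> g) = m \<cdot> r"
    using comp_reassoc[OF eqs(2), of g] e p jq(1) m(6) by simp
  then obtain y where y: "y \<in> Mor C" "Src C y = Tgt C m'" "Tgt C y = Tgt C r" "m' \<cdot> y = e \<cdot> g" "j' \<cdot> y = r"
    by (rule weak_pushout_induced[OF po(1), of "e \<cdot> g" r, rotated 5]) (use e p m in simp_all)
  have "y \<in> Den C"
    using Den_cancel(1)[of j' y] y D po(2) m(3) by simp
  show ?thesis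
    by (rule that[of e u j d' u' m' j' y])
      (use e u jq(1) j eqs dpb po y \<open>y \<in> Den C\<close> m(5) in simp_all)
qed

text \<open>Both composites are computed with S- and T-factors and joined by the zigzag of part (a).
  Its left S-column and right T-column are transposed by \<open>transpose_column\<close> and its
  dual; the rows \<open>tf1\<close> and \<open>tf2\<close> come from the weak pullback and weak
  pushout obtained there.\<close>

lemma Frac_eq_imp_square:
  assumes A: "(b1, f1, a1) \<in> three_arrows C X Y" and P2: "(p2, g2, i2) \<in> normal_three_arrows C Y Z"
    and P1: "(p1, g1, i1) \<in> normal_three_arrows C X' Y'" and B: "(b2, f2, a2) \<in> three_arrows C Y' Z'"
    and eq: "double_fraction C (b1, f1, a1) \<cdot>\<^bsub>Frac C\<^esub> double_fraction C (p2, g2, i2)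
      = double_fraction C (p1, g1, i1) \<cdot>\<^bsub>Frac C\<^esub> double_fraction C (b2, f2, a2)"
  shows "\<exists>tb1 tf1 ta1 tb2 tf2 ta2 tp1 tg1 ti1 tp2 tg2 ti2.
     (tb1, tf1, ta1) \<in> three_arrows C (Src C g1) (Src C g2) \<and>
     (tb2, tf2, ta2) \<in> three_arrows C (Tgt C g1) (Tgt C g2) \<and>
     (tp1, tg1, ti1) \<in> normal_three_arrows C (Src C f1) (Src C f2) \<and>
     (tp2, tg2, ti2) \<in> normal_three_arrows C (Tgt C f1) (Tgt C f2) \<and>
     tg1 \<in> hom C (Src C tf1) (Src C tf2) \<and>
     tg2 \<in> hom C (Tgt C tf1) (Tgt C tf2) \<and>
     tb1 \<cdot> p1 = tp1 \<cdot> b1 \<and> tf1 \<cdot> tp2 = tp1 \<cdot> f1 \<and> ta1 \<cdot> tp2 = p2 \<cdot> a1 \<and>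
     tb1 \<cdot> g1 = tg1 \<cdot> tb2 \<and> tf1 \<cdot> tg2 = tg1 \<cdot> tf2 \<and> ta1 \<cdot> tg2 = g2 \<cdot> ta2 \<and>
     b2 \<cdot> i1 = ti1 \<cdot> tb2 \<and> f2 \<cdot> ti2 = ti1 \<cdot> tf2 \<and> a2 \<cdot> ti2 = i2 \<cdot> ta2"
proof -
  interpret D: uni_fractionable_category "dual C" by (rule uni_fractionable_dual)
  have P2': "(p2, g2, i2) \<in> three_arrows C Y Z" and P1': "(p1, g1, i1) \<in> three_arrows C X' Y'"
    and TS: "p2 \<in> TDen C" "i2 \<in> SDen C" "p1 \<in> TDen C" "i1 \<in> SDen C"
    using P1 P2 by (simp_all add: normal_three_arrows_iff)
  note F = A[unfolded three_arrows_iff] B[unfolded three_arrows_iff]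
    P1'[unfolded three_arrows_iff] P2'[unfolded three_arrows_iff]
  obtain j q q' h g j' where data1: "composition_data C f1 (p2 \<cdot> a1) g2 j q q' h g j'"
    and mem1: "j \<in> SDen C" "q \<in> TDen C" "q' \<in> TDen C" "j' \<in> SDen C"
    by (rule composition_data_exists[of "p2 \<cdot> a1" f1 g2]) (use F in simp_all)
  obtain k r r' m n k' where data2: "composition_data C g1 (b2 \<cdot> i1) f2 k r r' m n k'"
    and mem2: "k \<in> SDen C" "r \<in> TDen C" "r' \<in> TDen C" "k' \<in> SDen C"
    by (rule composition_data_exists[of "b2 \<cdot> i1" g1 f2]) (use F in simp_all)
  note E1 = data1[unfolded composition_data_def] and E2 = data2[unfolded composition_data_def]
  have "double_fraction C (q' \<cdot> b1, h \<cdot> g, i2 \<cdot> j') = double_fraction C (r' \<cdot> p1, m \<cdot> n, a2 \<cdot> k')"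
    using eq Frac_comp_double_fraction[OF A P2' compositeI[OF data1]]
      Frac_comp_double_fraction[OF P1' B compositeI[OF data2]] by simp
  then have "fraction_equal C (q' \<cdot> b1, h \<cdot> g, i2 \<cdot> j') (r' \<cdot> p1, m \<cdot> n, a2 \<cdot> k')"
    using double_fraction_eq_iff[OF composite_three_arrows[OF A P2' compositeI[OF data1]]] by simp
  from fraction_equal_imp_zigzag[OF this]
  obtain x1 y1 z1 x2 y2 z2 s1 s2 d1 d2 l1 l2 where
    s: "s1 \<in> TDen C" "s2 \<in> TDen C" and l: "l1 \<in> SDen C" "l2 \<in> SDen C"
    and up: "ladder C (x1, y1, z1) (s1, s2) (q' \<cdot> b1, h \<cdot> g, i2 \<cdot> j')"
    and mid: "ladder C (x1, y1, z1) (d1, d2) (x2, y2, z2)"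
    and low: "ladder C (r' \<cdot> p1, m \<cdot> n, a2 \<cdot> k') (l1, l2) (x2, y2, z2)"
    unfolding split_paired_Ex by blast
  note Z = up[unfolded ladder_iff] mid[unfolded ladder_iff] low[unfolded ladder_iff]
  \<comment> \<open>Once all sources and targets are rewritten to fixed object names, simplification
    settles every composability condition.\<close>
  define M0 E G U V U2 V2 N0 Fo H where objs: "M0 = Src C h" "E = Tgt C j" "G = Tgt C g" "U = Src C y1" "V = Tgt C y1" "U2 = Src C y2" "V2 = Tgt C y2" "N0 = Src C m" "Fo = Tgt C m" "H = Tgt C n"
  have f: "f1 \<in> Mor C" "f2 \<in> Mor C" "g1 \<in> Mor C" "g2 \<in> Mor C"
    "b1 \<in> Mor C" "Src C b1 = Src C f1" "Tgt C b1 = X" "a1 \<in> Mor C" "Src C a1 = Y" "Tgt C a1 = Tgt C f1"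
    "b2 \<in> Mor C" "Src C b2 = Src C f2" "Tgt C b2 = Y'" "a2 \<in> Mor C" "Src C a2 = Z'" "Tgt C a2 = Tgt C f2"
    "p1 \<in> Mor C" "Src C p1 = Src C g1" "Tgt C p1 = X'" "i1 \<in> Mor C" "Src C i1 = Y'" "Tgt C i1 = Tgt C g1"
    "p2 \<in> Mor C" "Src C p2 = Src C g2" "Tgt C p2 = Y" "i2 \<in> Mor C" "Src C i2 = Z" "Tgt C i2 = Tgt C g2"
    using F by simp_all
  have ty1: "q' \<in> Mor C" "Src C q' = M0" "Tgt C q' = Src C f1"
    "h \<in> Mor C" "Src C h = M0" "Tgt C h = E"
    "j \<in> Mor C" "Src C j = Src C g2" "Tgt C j = E"
    "q \<in> Mor C" "Src C q = E" "Tgt C q = Tgt C f1"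
    "g \<in> Mor C" "Src C g = E" "Tgt C g = G"
    "j' \<in> Mor C" "Src C j' = Tgt C g2" "Tgt C j' = G"
    using E1 by (simp_all add: objs[symmetric])
  have ty2: "k \<in> Mor C" "Src C k = Src C f2" "Tgt C k = Fo"
    "r \<in> Mor C" "Src C r = Fo" "Tgt C r = Tgt C g1"
    "r' \<in> Mor C" "Src C r' = N0" "Tgt C r' = Src C g1"
    "m \<in> Mor C" "Src C m = N0" "Tgt C m = Fo"
    "n \<in> Mor C" "Src C n = Fo" "Tgt C n = H"
    "k' \<in> Mor C" "Src C k' = Tgt C f2" "Tgt C k' = H"
    using E2 by (simp_all add: objs[symmetric])
  have ty3: "x1 \<in> Mor C" "Src C x1 = U" "Tgt C x1 = X"
    "y1 \<in> Mor C" "Src C y1 = U" "Tgt C y1 = V"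
    "z1 \<in> Mor C" "Src C z1 = Z" "Tgt C z1 = V"
    "s1 \<in> Mor C" "Src C s1 = U" "Tgt C s1 = M0"
    "s2 \<in> Mor C" "Src C s2 = V" "Tgt C s2 = G"
    using up[unfolded ladder_iff] by (simp_all add: f ty1 objs[symmetric])
  have ty4: "x2 \<in> Mor C" "Src C x2 = U2" "Tgt C x2 = X"
    "y2 \<in> Mor C" "Src C y2 = U2" "Tgt C y2 = V2"
    "z2 \<in> Mor C" "Src C z2 = Z" "Tgt C z2 = V2"
    "d1 \<in> Mor C" "Src C d1 = U" "Tgt C d1 = U2"
    "d2 \<in> Mor C" "Src C d2 = V" "Tgt C d2 = V2"
    using mid[unfolded ladder_iff] by (simp_all add: f ty3 objs[symmetric])
  have ty5: "l1 \<in> Mor C" "Src C l1 = N0" "Tgt C l1 = U2"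
    "l2 \<in> Mor C" "Src C l2 = H" "Tgt C l2 = V2"
    using low[unfolded ladder_iff] by (simp_all add: f ty2 ty4 objs[symmetric])
  note ty = ty1 ty2 ty3 ty4 ty5
  \<comment> \<open>The hypotheses leave the outer objects of the two composites unrelated; the
    ladders show that they agree.\<close>
  have X': "X' = X" and Z': "Z' = Z"
    using up mid low unfolding ladder_iff by (simp_all add: ty f)
  have eqs: "j \<cdot> q = p2 \<cdot> a1" "h \<cdot> q = q' \<cdot> f1" "j \<cdot> g = g2 \<cdot> j'"
    "k \<cdot> r = b2 \<cdot> i1" "m \<cdot> r = r' \<cdot> g1" "k \<cdot> n = f2 \<cdot> k'"
    "s1 \<cdot> (q' \<cdot> b1) = x1" "y1 \<cdot> s2 = s1 \<cdot> (h \<cdot> g)" "z1 \<cdot> s2 = i2 \<cdot> j'"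
    "d1 \<cdot> x2 = x1" "y1 \<cdot> d2 = d1 \<cdot> y2" "z1 \<cdot> d2 = z2"
    "l1 \<cdot> x2 = r' \<cdot> p1" "m \<cdot> (n \<cdot> l2) = l1 \<cdot> y2" "a2 \<cdot> (k' \<cdot> l2) = z2"
    using E1 E2 Z by (simp_all add: ty f X' Z')
  have Den: "x2 \<in> Den C" "z1 \<in> Den C"
    using Z by simp_all
  obtain eL uL aL dL vL mL bL yL where
    L: "eL \<in> Den C" "Tgt C eL = Src C p1" "uL \<in> TDen C" "Src C uL = Src C eL" "Tgt C uL = Src C x2"
      "aL \<in> SDen C" "Src C aL = Src C r'" "Tgt C aL = Src C eL"
      "eL \<cdot> p1 = uL \<cdot> x2" "aL \<cdot> eL = r'" "aL \<cdot> uL = l1"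
    and dL: "weak_pullback C d1 uL dL vL" "vL \<in> TDen C"
    and mL: "weak_pushout C aL m mL bL" "bL \<in> SDen C"
    and yL: "yL \<in> Den C" "Src C yL = Tgt C mL" "Tgt C yL = Tgt C g1" "mL \<cdot> yL = eL \<cdot> g1" "bL \<cdot> yL = r"
    by (rule transpose_column[of p1 g1 x2 l1 r' d1 m r])
      (use TS mem2 l Den in \<open>simp_all add: ty f X' eqs\<close>)
  \<comment> \<open>The dual application, to the right column \<open>s2\<close> of the T-ladder:
    \<open>i2\<close>, \<open>z1\<close> and \<open>g\<close> take the roles of \<open>p1\<close>,
    \<open>x2\<close> and \<open>m\<close>.\<close>
  obtain eR uR aR dR vR mR bR yR where
    R: "eR \<in> Den C" "Src C eR = Tgt C i2" "uR \<in> SDen C" "Tgt C uR = Tgt C eR" "Src C uR = Tgt C z1"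
      "aR \<in> TDen C" "Tgt C aR = Tgt C j'" "Src C aR = Tgt C eR"
      "i2 \<cdot> eR = z1 \<cdot> uR" "eR \<cdot> aR = j'" "uR \<cdot> aR = s2"
    and dR: "weak_pushout C uR d2 dR vR" "vR \<in> SDen C"
    and mR: "weak_pullback C g aR mR bR" "bR \<in> TDen C"
    and yR: "yR \<in> Den C" "Tgt C yR = Src C mR" "Src C yR = Src C g2" "yR \<cdot> mR = g2 \<cdot> eR" "yR \<cdot> bR = j"
    by (rule D.transpose_column[of i2 g2 z1 s2 j' d2 g j,
          unfolded dual_simps weak_pullback_dual weak_pushout_dual])
      (use TS mem1 s Den in \<open>simp_all add: ty f Z' eqs\<close>)
  note DL = weak_pullbackD[OF dL(1)] weak_pushoutD[OF mL(1)]
    and DR = weak_pushoutD[OF dR(1)] weak_pullbackD[OF mR(1)]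
  define W W' where W: "W = Src C eL" and W': "W' = Tgt C eR"
  define Ma Mb Na Nb where Ms: "Ma = Src C dL" "Mb = Src C mR" "Na = Tgt C mL" "Nb = Tgt C dR"
  have tyL: "eL \<in> Mor C" "Src C eL = W" "Tgt C eL = Src C g1" "uL \<in> Mor C" "Src C uL = W" "Tgt C uL = U2"
    "aL \<in> Mor C" "Src C aL = N0" "Tgt C aL = W" "dL \<in> Mor C" "Src C dL = Ma" "Tgt C dL = W"
    "vL \<in> Mor C" "Src C vL = Ma" "Tgt C vL = U" "mL \<in> Mor C" "Src C mL = W" "Tgt C mL = Na"
    "bL \<in> Mor C" "Src C bL = Fo" "Tgt C bL = Na" "yL \<in> Mor C" "Src C yL = Na" "Tgt C yL = Tgt C g1"
    unfolding W Ms using L(1-8) DL(1-8,10-17) yL(1-3) by (simp_all add: ty f)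
  have tyR: "eR \<in> Mor C" "Src C eR = Tgt C g2" "Tgt C eR = W'" "uR \<in> Mor C" "Src C uR = V" "Tgt C uR = W'"
    "aR \<in> Mor C" "Src C aR = W'" "Tgt C aR = G" "dR \<in> Mor C" "Src C dR = W'" "Tgt C dR = Nb"
    "vR \<in> Mor C" "Src C vR = V2" "Tgt C vR = Nb" "mR \<in> Mor C" "Src C mR = Mb" "Tgt C mR = W'"
    "bR \<in> Mor C" "Src C bR = Mb" "Tgt C bR = E" "yR \<in> Mor C" "Src C yR = Src C g2" "Tgt C yR = Mb"
    unfolding W' Ms using R(1-8) DR(1-8,10-17) yR(1-3) by (simp_all add: ty f)
  note types = f ty tyL tyR X' Z'
  have sqL: "dL \<cdot> uL = vL \<cdot> d1" and sqR: "uR \<cdot> dR = d2 \<cdot> vR"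
    using DL(9) DR(9) by simp_all
  \<comment> \<open>Compatibility over \<open>g\<close> is \<open>y1 \<cdot> uR \<cdot> aR = y1
    \<cdot> s2 = s1 \<cdot> h \<cdot> g\<close>, preceded by \<open>vL\<close>.\<close>
  obtain tf1 where tf1: "tf1 \<in> Mor C" "Tgt C tf1 = Src C mR" "Src C tf1 = Src C (vL \<cdot> (s1 \<cdot> h))"
      "tf1 \<cdot> mR = vL \<cdot> (y1 \<cdot> uR)" "tf1 \<cdot> bR = vL \<cdot> (s1 \<cdot> h)"
    by (rule weak_pullback_induced[OF mR(1), of "vL \<cdot> (y1 \<cdot> uR)" "vL \<cdot> (s1 \<cdot> h)"])
      (simp_all add: types R(11) eqs(8))
  have "aL \<cdot> (uL \<cdot> (y2 \<cdot> vR)) = m \<cdot> (n \<cdot> (l2 \<cdot> vR))"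
    using comp_reassoc[OF eqs(14), of vR] by (simp add: types comp_reassoc[OF L(11)])
  then obtain tf2 where tf2: "tf2 \<in> Mor C" "Src C tf2 = Tgt C mL" "Tgt C tf2 = Tgt C (n \<cdot> (l2 \<cdot> vR))"
      "mL \<cdot> tf2 = uL \<cdot> (y2 \<cdot> vR)" "bL \<cdot> tf2 = n \<cdot> (l2 \<cdot> vR)"
    by (rule weak_pushout_induced[OF mL(1), of "uL \<cdot> (y2 \<cdot> vR)" "n \<cdot> (l2 \<cdot> vR)", rotated 5])
      (simp_all add: types)
  have tf: "Src C tf1 = Ma" "Tgt C tf1 = Mb" "Src C tf2 = Na" "Tgt C tf2 = Nb"
    using tf1(2,3) tf2(2,3) by (simp_all add: types)
  note types = types tf tf1(1) tf2(1)
  \<comment> \<open>The nine required equations in order. The rows are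
    \<open>(dL \<cdot> eL, tf1, yR)\<close> and \<open>(yL, tf2, eR \<cdot> dR)\<close>; the columns
    are \<open>(vL \<cdot> s1 \<cdot> q', dL \<cdot> mL, k \<cdot> bL)\<close> and
    \<open>(bR \<cdot> q, mR \<cdot> dR, k' \<cdot> l2 \<cdot> vR)\<close>.\<close>
  have "(dL \<cdot> eL) \<cdot> p1 = (vL \<cdot> (s1 \<cdot> q')) \<cdot> b1"
    by (simp add: types L(9) comp_reassoc[OF sqL] eqs(7,10))
  moreover have "tf1 \<cdot> (bR \<cdot> q) = (vL \<cdot> (s1 \<cdot> q')) \<cdot> f1"
    by (simp add: types comp_reassoc[OF tf1(5)] eqs(2))
  moreover have "yR \<cdot> (bR \<cdot> q) = p2 \<cdot> a1"
    by (simp add: types comp_reassoc[OF yR(5)] eqs(1))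
  moreover have "(dL \<cdot> eL) \<cdot> g1 = (dL \<cdot> mL) \<cdot> yL"
    by (simp add: types yL(4))
  moreover have "tf1 \<cdot> (mR \<cdot> dR) = (dL \<cdot> mL) \<cdot> tf2"
    by (simp add: types comp_reassoc[OF tf1(4)] sqR comp_reassoc[OF eqs(11)] tf2(4) comp_reassoc[OF sqL])
  moreover have "yR \<cdot> (mR \<cdot> dR) = g2 \<cdot> (eR \<cdot> dR)"
    by (simp add: types comp_reassoc[OF yR(4)])
  moreover have "b2 \<cdot> i1 = (k \<cdot> bL) \<cdot> yL"
    by (simp add: types yL(5) eqs(4))
  moreover have "f2 \<cdot> (k' \<cdot> (l2 \<cdot> vR)) = (k \<cdot> bL) \<cdot> tf2"
    by (simp add: types tf2(5) comp_reassoc[OF eqs(6)])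
  moreover have "a2 \<cdot> (k' \<cdot> (l2 \<cdot> vR)) = i2 \<cdot> (eR \<cdot> dR)"
    using comp_reassoc[OF eqs(15), of vR]
    by (simp add: types comp_reassoc[OF R(9)] sqR comp_reassoc[OF eqs(12)])
  \<comment> \<open>In \<open>dL \<cdot> uL = vL \<cdot> d1\<close> all other morphisms are
    denominators, so semi-saturation applies.\<close>
  moreover have "dL \<in> Den C"
    using Den_cancel(2)[of dL uL] L(3) dL(2) Z by (simp add: types sqL)
  then have "(dL \<cdot> eL, tf1, yR) \<in> three_arrows C (Src C g1) (Src C g2)"
    using L(1) yR(1) by (simp add: three_arrows_iff types)
  moreover have "dR \<in> Den C"
    using Den_cancel(1)[of uR dR] R(3) dR(2) Z by (simp add: types sqR)
  then have "(yL, tf2, eR \<cdot> dR) \<in> three_arrows C (Tgt C g1) (Tgt C g2)"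
    using R(1) yL(1) by (simp add: three_arrows_iff types)
  moreover have "(vL \<cdot> (s1 \<cdot> q'), dL \<cdot> mL, k \<cdot> bL) \<in> normal_three_arrows C (Src C f1) (Src C f2)"
    using dL(2) s(1) mem1(3) mem2(1) mL(2)
    by (simp add: normal_three_arrows_iff three_arrows_iff types)
  moreover have "(bR \<cdot> q, mR \<cdot> dR, k' \<cdot> (l2 \<cdot> vR)) \<in> normal_three_arrows C (Tgt C f1) (Tgt C f2)"
    using mR(2) mem1(2) mem2(4) l(2) dR(2)
    by (simp add: normal_three_arrows_iff three_arrows_iff types)
  moreover have "dL \<cdot> mL \<in> hom C (Src C tf1) (Src C tf2)" "mR \<cdot> dR \<in> hom C (Tgt C tf1) (Tgt C tf2)"
    by (simp_all add: hom_iff types)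
  ultimately show ?thesis
    by - (rule exI[of _ "dL \<cdot> eL"], rule exI[of _ tf1], rule exI[of _ yR],
      rule exI[of _ yL], rule exI[of _ tf2], rule exI[of _ "eR \<cdot> dR"],
      rule exI[of _ "vL \<cdot> (s1 \<cdot> q')"], rule exI[of _ "dL \<cdot> mL"], rule exI[of _ "k \<cdot> bL"],
      rule exI[of _ "bR \<cdot> q"], rule exI[of _ "mR \<cdot> dR"], rule exI[of _ "k' \<cdot> (l2 \<cdot> vR)"],
      intro conjI; assumption)
qed

end

theorem proposition5p17:
  fixes C :: "('o, 'm, 'x) uni_fractionable_category_scheme" (structure)
  assumes "uni_fractionable_category C"
  shows
    "(\<forall>X Y b1 f1 a1 b2 f2 a2.
        (b1, f1, a1) \<in> three_arrows C X Y \<longrightarrow> (b2, f2, a2) \<in> three_arrows C X Y \<longrightarrow>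
        (double_fraction C (b1, f1, a1) = double_fraction C (b2, f2, a2) \<longleftrightarrow>
          (\<exists>tb1 tf1 ta1 tb2 tf2 ta2 p1 d1 i1 p2 d2 i2.
             (tb1, tf1, ta1) \<in> three_arrows C X Y \<and>
             (tb2, tf2, ta2) \<in> three_arrows C X Y \<and>
             (p1, d1, i1) \<in> normal_three_arrows C (Src C f1) (Src C f2) \<and>
             (p2, d2, i2) \<in> normal_three_arrows C (Tgt C f1) (Tgt C f2) \<and>
             d1 \<in> Den C \<and> d1 \<in> hom C (Src C tf1) (Src C tf2) \<and>
             d2 \<in> Den C \<and> d2 \<in> hom C (Tgt C tf1) (Tgt C tf2) \<and>
             tb1 = p1 \<cdot> b1 \<and> tf1 \<cdot> p2 = p1 \<cdot> f1 \<and> ta1 \<cdot> p2 = a1 \<and>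
             tb1 = d1 \<cdot> tb2 \<and> tf1 \<cdot> d2 = d1 \<cdot> tf2 \<and> ta1 \<cdot> d2 = ta2 \<and>
             b2 = i1 \<cdot> tb2 \<and> f2 \<cdot> i2 = i1 \<cdot> tf2 \<and> a2 \<cdot> i2 = ta2)) \<and>
        ((b1, f1, a1) \<in> normal_three_arrows C X Y \<longrightarrow>
         (b2, f2, a2) \<in> normal_three_arrows C X Y \<longrightarrow>
         (double_fraction C (b1, f1, a1) = double_fraction C (b2, f2, a2) \<longleftrightarrow>
           (\<exists>tb1 tf1 ta1 tb2 tf2 ta2 p1 d1 i1 p2 d2 i2.
              (tb1, tf1, ta1) \<in> normal_three_arrows C X Y \<and>
              (tb2, tf2, ta2) \<in> normal_three_arrows C X Y \<and>
              (p1, d1, i1) \<in> normal_three_arrows C (Src C f1) (Src C f2) \<and>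
              (p2, d2, i2) \<in> normal_three_arrows C (Tgt C f1) (Tgt C f2) \<and>
              d1 \<in> Den C \<and> d1 \<in> hom C (Src C tf1) (Src C tf2) \<and>
              d2 \<in> Den C \<and> d2 \<in> hom C (Tgt C tf1) (Tgt C tf2) \<and>
              tb1 = p1 \<cdot> b1 \<and> tf1 \<cdot> p2 = p1 \<cdot> f1 \<and> ta1 \<cdot> p2 = a1 \<and>
              tb1 = d1 \<cdot> tb2 \<and> tf1 \<cdot> d2 = d1 \<cdot> tf2 \<and> ta1 \<cdot> d2 = ta2 \<and>
              b2 = i1 \<cdot> tb2 \<and> f2 \<cdot> i2 = i1 \<cdot> tf2 \<and> a2 \<cdot> i2 = ta2))))
     \<and>
     (\<forall>X X' Y Y' Z Z' b1 f1 a1 b2 f2 a2 p1 g1 i1 p2 g2 i2.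
        (b1, f1, a1) \<in> three_arrows C X Y \<longrightarrow>
        (p2, g2, i2) \<in> normal_three_arrows C Y Z \<longrightarrow>
        (p1, g1, i1) \<in> normal_three_arrows C X' Y' \<longrightarrow>
        (b2, f2, a2) \<in> three_arrows C Y' Z' \<longrightarrow>
        (double_fraction C (b1, f1, a1) \<cdot>\<^bsub>Frac C\<^esub> double_fraction C (p2, g2, i2)
           = double_fraction C (p1, g1, i1) \<cdot>\<^bsub>Frac C\<^esub> double_fraction C (b2, f2, a2) \<longleftrightarrow>
          (\<exists>tb1 tf1 ta1 tb2 tf2 ta2 tp1 tg1 ti1 tp2 tg2 ti2.
             (tb1, tf1, ta1) \<in> three_arrows C (Src C g1) (Src C g2) \<and>
             (tb2, tf2, ta2) \<in> three_arrows C (Tgt C g1) (Tgt C g2) \<and>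
             (tp1, tg1, ti1) \<in> normal_three_arrows C (Src C f1) (Src C f2) \<and>
             (tp2, tg2, ti2) \<in> normal_three_arrows C (Tgt C f1) (Tgt C f2) \<and>
             tg1 \<in> hom C (Src C tf1) (Src C tf2) \<and>
             tg2 \<in> hom C (Tgt C tf1) (Tgt C tf2) \<and>
             tb1 \<cdot> p1 = tp1 \<cdot> b1 \<and> tf1 \<cdot> tp2 = tp1 \<cdot> f1 \<and> ta1 \<cdot> tp2 = p2 \<cdot> a1 \<and>
             tb1 \<cdot> g1 = tg1 \<cdot> tb2 \<and> tf1 \<cdot> tg2 = tg1 \<cdot> tf2 \<and> ta1 \<cdot> tg2 = g2 \<cdot> ta2 \<and>
             b2 \<cdot> i1 = ti1 \<cdot> tb2 \<and> f2 \<cdot> ti2 = ti1 \<cdot> tf2 \<and> a2 \<cdot> ti2 = i2 \<cdot> ta2)))"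
proof -
  interpret uni_fractionable_category C by (rule assms)
  show ?thesis
  proof (intro conjI allI impI, goal_cases)
    case 1
    then show ?case by (rule double_fraction_eq_iff_diagram)
  next
    case 2
    from 2(3,4) show ?case by (rule double_fraction_eq_iff_normal_diagram)
  next
    case (3 X X' Y Y' Z Z' b1 f1 a1 b2 f2 a2 p1 g1 i1 p2 g2 i2)
    then have N: "(p2, g2, i2) \<in> three_arrows C Y Z" "(p1, g1, i1) \<in> three_arrows C X' Y'"
      by (simp_all add: normal_three_arrows_iff)
    show ?case
      by (rule iffI, erule Frac_eq_imp_square[OF 3],
          elim exE conjE, rule square_imp_Frac_eq[OF 3(1) N 3(4)]; assumption)
  qed
qed

end
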